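(* Let $S$ be a $\widetilde G(\mathbb R^d)$-valued random variable (the signature $S=S(X)_{0,T}$ of the rough path lift of a stochastic process $X$) such that $\sum_{k\ge0}\lambda^k\|\mathbb E S^k\|_{(\mathbb R^d)^{\otimes k}}<\infty$ for all $\lambda>0$, and let $\mathcal G$ be the $\sigma$-algebra generated by $S$. Then for every $Y\in L^2(\mathcal G)$, $$Y=\sum_{n=0}^\infty \Pi^n Y=\sum_{v\,:\,(\widetilde p_v,\widetilde p_v)>0}\langle \ell^Y_v,S\rangle,\qquad \ell^Y_v:=\frac{\mathbb E\big[Y\langle\widetilde p_v,S\rangle\big]}{(\widetilde p_v,\widetilde p_v)}\,\widetilde p_v ,$$ with both series converging in $L^2$.
   Context: $T((\mathbb R^d))=\prod_{k\ge0}(\mathbb R^d)^{\otimes k}$. For a word $w$ of length $|w|=k$ in $\{1,\dots,d\}$, $\langle w,S\rangle$ is the corresponding coordinate of $S^k$, extended linearly to linear combinations of words. $\widetilde G(\mathbb R^d)$ is the set of $S\in T((\mathbb R^d))$ with $S^0=1$, $\langle u,S\rangle\langle v,S\rangle=\langle u\sqcup\!\sqcup v,S\rangle$ for all words $u,v$ ($\sqcup\!\sqcup$ the shuffle product), and $\sum_k\lambda^k\|S^k\|<\infty$ for all $\lambda>0$ (norms: $\ell^1$ on $\mathbb R^d$, projective tensor norms on $(\mathbb R^d)^{\otimes k}$), with the topology of these norms. All coordinates $\langle w,S\rangle$ are in $L^2(\mathcal G)$. Define the positive semi-definite form $(u,v):=\mathbb E\langle u,S\rangle\langle v,S\rangle$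 on linear combinations of words. Order words by: $v<w$ if $|v|<|w|$, or $|v|=|w|$ and $v$ precedes $w$ lexicographically. Define recursively $$\widetilde p_w:=w-\sum_{v<w,\ (\widetilde p_v,\widetilde p_v)>0}\frac{(w,\widetilde p_v)}{(\widetilde p_v,\widetilde p_v)}\widetilde p_v .$$ Let $\Pi_N$ be the orthogonal projection in $L^2(\mathcal G)$ onto $\mathrm{span}\{\langle w,S\rangle: |w|\le N\}$, and let $\Pi^n:=\Pi_n-\Pi_{n-1}$ (with $\Pi_{-1}:=0$). *)

theory Defs
  imports "HOL-Probability.Probability" "HOL-Library.Poly_Mapping"
begin

text \<open>
  The alphabet \<open>{1,\<dots>,d}\<close> is a type \<open>'d\<close> of sort \<open>{finite, linorder}\<close>, so that
  \<open>d = CARD('d)\<close> and \<open>\<real>\<^sup>d\<close> is \<open>real ^ 'd\<close>. A word is a list of letters. An element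
  \<open>T\<close> of \<open>T((\<real>\<^sup>d))\<close> is the family of its coordinates, a function on words; its component
  in level \<open>k\<close> is the restriction of this function to the words of length \<open>k\<close>.
\<close>

type_synonym 'd tseries = "'d list \<Rightarrow> real"
type_synonym 'd words = "'d list \<Rightarrow>\<^sub>0 real"


section \<open>Norms and topology\<close>

definition l1_norm :: "real ^ 'd::finite \<Rightarrow> real" where
  "l1_norm v = (\<Sum>i\<in>UNIV. \<bar>v $ i\<bar>)"

text \<open>
  Coordinates of the elementary tensor of a list of vectors, on words of the same length
  (\<open>zip\<close> would truncate otherwise).
\<close>

definition elem_tensor :: "(real ^ 'd::finite) list \<Rightarrow> 'd tseries" where
  "elem_tensor vs w = prod_list (map (\<lambda>(v, i). v $ i) (zip vs w))"

text \<open>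
  The projective norm of the level \<open>k\<close> component of \<open>T\<close>: the infimum over all representations
  as a finite sum of scalar multiples of elementary tensors. The explicit scalars are only
  needed for \<open>k = 0\<close>.
\<close>

definition proj_norm :: "nat \<Rightarrow> 'd::finite tseries \<Rightarrow> real" where
  "proj_norm k T = Inf {\<Sum>(c, vs)\<leftarrow>L. \<bar>c\<bar> * prod_list (map l1_norm vs) | L.
     (\<forall>(c, vs)\<in>set L. length vs = k) \<and>
     (\<forall>w. length w = k \<longrightarrow> T w = (\<Sum>(c, vs)\<leftarrow>L. c * elem_tensor vs w))}"

text \<open>As a check of the definition: it is the \<open>\<ell>\<^sup>1\<close> norm of the coordinates.\<close>

lemma elem_tensor_simps:
  "elem_tensor [] w = 1"
  "elem_tensor (v # vs) (i # w) = v $ i * elem_tensor vs w"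
  by (simp_all add: elem_tensor_def)

lemma finite_words: "finite {w :: 'd::finite list. length w = k}"
  using finite_lists_length_eq[of "UNIV :: 'd set" k] by simp

lemma sum_words_Suc:
  "(\<Sum>w | length w = Suc k. f w) = (\<Sum>i\<in>UNIV. \<Sum>w | length w = k. f (i # w))"
  for f :: "'d::finite list \<Rightarrow> real"
proof -
  have "(\<Sum>i\<in>UNIV. \<Sum>w | length w = k. f (i # w)) =
      (\<Sum>(i, w)\<in>UNIV \<times> {w. length w = k}. f (i # w))"
    by (simp add: sum.cartesian_product)
  also have "\<dots> = (\<Sum>w | length w = Suc k. f w)"
    by (rule sum.reindex_bij_witness[where i = "\<lambda>w. (hd w, tl w)" and j = "\<lambda>(i, w). i # w"])
       (auto simp: length_Suc_conv)
  finally show ?thesis by simp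
qed

lemma sum_elem_tensor:
  "(\<Sum>w | length w = length vs. \<bar>elem_tensor vs w\<bar>) = prod_list (map l1_norm vs)"
proof (induction vs)
  case Nil
  then show ?case by (simp add: elem_tensor_simps)
next
  case (Cons v vs)
  then show ?case
    by (simp add: sum_words_Suc elem_tensor_simps abs_mult l1_norm_def
        flip: sum_distrib_left sum_distrib_right)
qed

lemma elem_tensor_axis:
  "length u = length w \<Longrightarrow>
    elem_tensor (map (\<lambda>i. axis i 1) u) w = (if u = w then 1 else 0)"
  by (induction u w rule: list_induct2) (auto simp: elem_tensor_simps axis_def)

lemma l1_norm_axis: "l1_norm (axis i 1) = 1"
proof -
  have "(\<Sum>j\<in>UNIV. \<bar>(axis i 1 :: real ^ 'a) $ j\<bar>) = (\<Sum>j\<in>UNIV. if j = i then 1 else 0)"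
    by (rule sum.cong) (auto simp: axis_def)
  then show ?thesis by (simp add: l1_norm_def)
qed

lemma proj_norm_eq: "proj_norm k T = (\<Sum>w | length w = k. \<bar>T w\<bar>)"
proof -
  define R where "R = {\<Sum>(c, vs)\<leftarrow>L. \<bar>c\<bar> * prod_list (map l1_norm vs) | L.
     (\<forall>(c, vs)\<in>set L. length vs = k) \<and>
     (\<forall>w. length w = k \<longrightarrow> T w = (\<Sum>(c, vs)\<leftarrow>L. c * elem_tensor vs w))}"
  let ?s = "\<Sum>w | length w = k. \<bar>T w\<bar>"
  have lower: "?s \<le> r" if r_in: "r \<in> R" for r
  proof -
    obtain L where r: "r = (\<Sum>(c, vs)\<leftarrow>L. \<bar>c\<bar> * prod_list (map l1_norm vs))"
      and len: "\<forall>(c, vs)\<in>set L. length vs = k"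
      and T: "\<forall>w. length w = k \<longrightarrow> T w = (\<Sum>(c, vs)\<leftarrow>L. c * elem_tensor vs w)"
      using r_in unfolding R_def by blast
    have "?s = (\<Sum>w | length w = k. \<bar>\<Sum>(c, vs)\<leftarrow>L. c * elem_tensor vs w\<bar>)"
      using T by (intro sum.cong) auto
    also have "\<dots> \<le> (\<Sum>(c, vs)\<leftarrow>L. \<bar>c\<bar> * prod_list (map l1_norm vs))"
      using len
    proof (induction L)
      case Nil
      then show ?case by simp
    next
      case (Cons x L)
      obtain c vs where x: "x = (c, vs)" by force
      have "(\<Sum>w | length w = k. \<bar>\<Sum>(c, vs)\<leftarrow>x # L. c * elem_tensor vs w\<bar>) \<le>
          (\<Sum>w | length w = k. \<bar>c\<bar> * \<bar>elem_tensor vs w\<bar> +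
             \<bar>\<Sum>(c, vs)\<leftarrow>L. c * elem_tensor vs w\<bar>)"
        unfolding x by (intro sum_mono) (simp flip: abs_mult)
      also have "\<dots> = \<bar>c\<bar> * prod_list (map l1_norm vs) +
          (\<Sum>w | length w = k. \<bar>\<Sum>(c, vs)\<leftarrow>L. c * elem_tensor vs w\<bar>)"
        using Cons.prems x
        by (auto simp: sum.distrib simp flip: sum_elem_tensor sum_distrib_left)
      finally show ?case using Cons x by simp
    qed
    finally show ?thesis using r by simp
  qed
  have "?s \<in> R"
  proof -
    obtain ws where ws: "set ws = {w :: 'a list. length w = k}" "distinct ws"
      using finite_distinct_list[OF finite_words] by blast
    define L where "L = map (\<lambda>w. (T w, map (\<lambda>i. axis i (1 :: real)) w)) ws"
    have norm1: "prod_list (map l1_norm (map (\<lambda>i. axis i (1 :: real)) w)) = 1" for w :: "'a list"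
      by (induction w) (simp_all add: l1_norm_axis)
    have "(\<Sum>(c, vs)\<leftarrow>L. \<bar>c\<bar> * prod_list (map l1_norm vs)) = (\<Sum>w\<leftarrow>ws. \<bar>T w\<bar>)"
      unfolding L_def by (simp add: comp_def norm1[unfolded map_map comp_def])
    then have "(\<Sum>(c, vs)\<leftarrow>L. \<bar>c\<bar> * prod_list (map l1_norm vs)) = ?s"
      using ws by (simp add: sum_list_distinct_conv_sum_set)
    moreover have "\<forall>(c, vs)\<in>set L. length vs = k"
      using ws by (auto simp: L_def)
    moreover have "T w = (\<Sum>(c, vs)\<leftarrow>L. c * elem_tensor vs w)" if "length w = k" for w
    proof -
      have "(\<Sum>(c, vs)\<leftarrow>L. c * elem_tensor vs w) =
          (\<Sum>u\<leftarrow>ws. T u * elem_tensor (map (\<lambda>i. axis i 1) u) w)"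
        unfolding L_def by (simp add: comp_def)
      also have "\<dots> = (\<Sum>u | length u = k. T u * elem_tensor (map (\<lambda>i. axis i 1) u) w)"
        using ws by (simp add: sum_list_distinct_conv_sum_set)
      also have "\<dots> = (\<Sum>u | length u = k. if u = w then T u else 0)"
        using that by (intro sum.cong) (auto simp: elem_tensor_axis)
      also have "\<dots> = T w"
        using that finite_words[of k, where 'd = 'a] by simp
      finally show ?thesis by simp
    qed
    ultimately show ?thesis unfolding R_def by (intro CollectI exI[of _ L]) auto
  qed
  with lower have "Inf R = ?s" by (intro cInf_eq_minimum) auto
  then show ?thesis by (simp add: proj_norm_def R_def)
qed

definition tseries_norm :: "real \<Rightarrow> 'd::finite tseries \<Rightarrow> real" where
  "tseries_norm l T = suminf (\<lambda>k. l ^ k * proj_norm k T)"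

definition entire_tseries :: "'d::finite tseries set" where
  "entire_tseries = {T. \<forall>l>0. summable (\<lambda>k. l ^ k * proj_norm k T)}"

definition entire_topology :: "'d::finite tseries topology" where
  "entire_topology = topology_generated_by
     {{T \<in> entire_tseries. tseries_norm l (\<lambda>w. T w - T0 w) < e} | T0 l e.
        T0 \<in> entire_tseries \<and> l > 0 \<and> e > 0}"


section \<open>Linear combinations of words\<close>

abbreviation word :: "'d list \<Rightarrow> 'd words" where
  "word w \<equiv> Poly_Mapping.single w 1"

definition scale :: "real \<Rightarrow> 'd words \<Rightarrow> 'd words" where
  "scale c p = Poly_Mapping.map ((*) c) p"

definition pairing :: "'d words \<Rightarrow> 'd tseries \<Rightarrow> real" where
  "pairing p T = (\<Sum>w\<in>Poly_Mapping.keys p. Poly_Mapping.lookup p w * T w)"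

definition prepend :: "'d \<Rightarrow> 'd words \<Rightarrow> 'd words" where
  "prepend a p = (\<Sum>w\<in>Poly_Mapping.keys p. Poly_Mapping.single (a # w) (Poly_Mapping.lookup p w))"

fun shuffle :: "'d list \<Rightarrow> 'd list \<Rightarrow> 'd words" where
  "shuffle [] v = word v"
| "shuffle u [] = word u"
| "shuffle (a # u) (b # v) = prepend a (shuffle u (b # v)) + prepend b (shuffle (a # u) v)"

definition word_less :: "'d::linorder list \<Rightarrow> 'd list \<Rightarrow> bool" (infix \<open>\<prec>\<close> 50) where
  "v \<prec> w \<longleftrightarrow> (v, w) \<in> lenlex {(a, b). a < b}"


section \<open>The group and its Borel sets\<close>

definition grouplike :: "'d::finite tseries set" where
  "grouplike = {T \<in> entire_tseries. T [] = 1 \<and> (\<forall>u v. T u * T v = pairing (shuffle u v) T)}"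

definition borel_grouplike :: "'d::finite tseries measure" where
  "borel_grouplike = sigma grouplike {U. openin (subtopology entire_topology grouplike) U}"


section \<open>Square integrable functions and orthogonal projections\<close>

text \<open>
  Elements of \<open>L\<^sup>2(F)\<close>, for a sub-\<open>\<sigma>\<close>-algebra \<open>F\<close>, are represented by functions; the measure
  component of \<open>F\<close> is irrelevant.
\<close>

definition L2 :: "'a measure \<Rightarrow> 'a measure \<Rightarrow> ('a \<Rightarrow> real) set" where
  "L2 M F = {f \<in> borel_measurable F. integrable M (\<lambda>x. (f x)\<^sup>2)}"

definition L2_inner :: "'a measure \<Rightarrow> ('a \<Rightarrow> real) \<Rightarrow> ('a \<Rightarrow> real) \<Rightarrow> real" where
  "L2_inner M f g = (\<integral>x. f x * g x \<partial>M)"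

definition L2_norm :: "'a measure \<Rightarrow> ('a \<Rightarrow> real) \<Rightarrow> real" where
  "L2_norm M f = sqrt (L2_inner M f f)"

definition L2_tendsto ::
  "'a measure \<Rightarrow> 'a measure \<Rightarrow> ('i \<Rightarrow> 'a \<Rightarrow> real) \<Rightarrow> ('a \<Rightarrow> real) \<Rightarrow> 'i filter \<Rightarrow> bool" where
  "L2_tendsto M F Z Y net \<longleftrightarrow> Y \<in> L2 M F \<and> (\<forall>\<^sub>F i in net. Z i \<in> L2 M F) \<and>
     ((\<lambda>i. L2_norm M (\<lambda>x. Z i x - Y x)) \<longlongrightarrow> 0) net"

text \<open>A representative of the orthogonal projection of \<open>Y\<close> onto \<open>V\<close>, unique up to null sets.\<close>

definition orth_proj :: "'a measure \<Rightarrow> ('a \<Rightarrow> real) set \<Rightarrow> ('a \<Rightarrow> real) \<Rightarrow> 'a \<Rightarrow> real" where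
  "orth_proj M V Y = (SOME Z. Z \<in> V \<and> (\<forall>U\<in>V. L2_inner M (\<lambda>x. Y x - Z x) U = 0))"


section \<open>The chaos decomposition of a random group-like element\<close>

context
  fixes M :: "'a measure" and S :: "'a \<Rightarrow> 'd::{finite, linorder} tseries"
begin

definition sig_algebra :: "'a measure" where
  "sig_algebra = vimage_algebra (space M) S borel_grouplike"

definition form :: "'d words \<Rightarrow> 'd words \<Rightarrow> real" where
  "form p q = L2_inner M (\<lambda>x. pairing p (S x)) (\<lambda>x. pairing q (S x))"

context
  notes conj_cong [fundef_cong] Collect_cong [fundef_cong]
begin

function orth_poly :: "'d list \<Rightarrow> 'd words" where
  "orth_poly w = word w - (\<Sum>v\<in>{v. v \<prec> w \<and> form (orth_poly v) (orth_poly v) > 0}.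
     scale (form (word w) (orth_poly v) / form (orth_poly v) (orth_poly v)) (orth_poly v))"
  by auto
termination
proof (relation "lenlex {(a, b). a < b}")
  have "trans {(a :: 'd, b). a < b}"
    by (auto simp: trans_def)
  then have "wf {(a :: 'd, b). a < b}"
    by (intro finite_acyclic_wf) (auto simp: acyclic_def trancl_id)
  then show "wf (lenlex {(a :: 'd, b). a < b})"
    by (rule wf_lenlex)
qed (auto simp: word_less_def)

end

declare orth_poly.simps [simp del]

definition proj_upto :: "nat \<Rightarrow> ('a \<Rightarrow> real) \<Rightarrow> 'a \<Rightarrow> real" where
  "proj_upto N = orth_proj M
     {\<lambda>x. pairing p (S x) | p. Poly_Mapping.keys p \<subseteq> {w. length w \<le> N}}"

definition proj_level :: "nat \<Rightarrow> ('a \<Rightarrow> real) \<Rightarrow> 'a \<Rightarrow> real" where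
  "proj_level n Y x = proj_upto n Y x - (if n = 0 then 0 else proj_upto (n - 1) Y x)"

definition chaos_coeff :: "('a \<Rightarrow> real) \<Rightarrow> 'd list \<Rightarrow> 'd words" where
  "chaos_coeff Y v = scale
     (L2_inner M Y (\<lambda>x. pairing (orth_poly v) (S x)) / form (orth_poly v) (orth_poly v))
     (orth_poly v)"

end

end

theory Submission
  imports Defs
begin

text \<open>
  The partial sums of both expansions are best approximations of \<open>Y\<close> by finite linear combinations
  of coordinates: those of the first are the projections onto the levels up to \<open>N - 1\<close>, those of
  the second the projections onto the span of finitely many orthogonal polynomials, and by
  Gram--Schmidt every linear combination of words lies in such a span up to null sets. So
  convergence follows once the linear functionals \<open>\<langle>p, S\<rangle>\<close> are known to be dense in
  \<open>L\<^sup>2\<close> of the \<open>\<sigma>\<close>-algebra generated by \<open>S\<close> (\<open>linear_functionals_dense\<close>).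

  By the shuffle relation these functionals form an algebra, but the law of a coordinate need not be
  determined by its moments, so density has to be proved through bounded functions, namely matrix
  coefficients of orthogonal representations of the group. An assignment of skew-symmetric matrices
  to the letters extends to words by multiplication, and the functional with coefficients
  \<open>w \<mapsto> (A\<^sub>w)\<^sub>p\<^sub>q\<close> is an entry of an orthogonal matrix when evaluated at a group-like series; hence it
  is bounded by 1 (\<open>functional_path_coeff_le_1\<close>). Three facts are needed.

  \<^item> The matrix coefficients lie in the closure of the linear functionals, and so do all their
    products. By the shuffle relation, a product of functionals is again a functional, whose
    coefficients still grow at most geometrically in the length of the word
    (\<open>functional_mult\<close>, \<open>geom_bounded_deshuffle\<close>). Such a functional of \<open>S\<close> converges in mean
    square (\<open>functional_closure\<close>): the square of the coordinate at \<open>w\<close> is the coordinate at the shuffle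
    of \<open>w\<close> with itself, so that its expectation is at most \<open>4\<^sup>k\<close> times the norm of level \<open>2k\<close> of the
    expected signature, where \<open>k\<close> is the length of \<open>w\<close>.

  \<^item> The matrix coefficients generate all of the Borel sets. For a word \<open>w\<close> of length \<open>k\<close>, let the
    letters act on \<open>\<real>\<^sup>k\<^sup>+\<^sup>1\<close> by the skew adjacency matrices of a path whose edges are labelled by the
    letters of \<open>w\<close>. The only word of length at most \<open>k\<close> that leads from one end of the path to the
    other is \<open>w\<close>, so the coordinate at \<open>w\<close> is the coefficient of degree \<open>k\<close>, and the lower ones vanish, when
    the corresponding matrix entry is expanded in powers of a common scaling factor of the matrices
    (\<open>functional_path_coeff_tendsto\<close>). The coordinates in turn generate the Borel sets, as the
    space of entire series is separable (\<open>measurable_borel_grouplike\<close>).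

  \<^item> A closed subspace of \<open>L\<^sup>2\<close> that contains all products of a family of bounded functions
    contains every square integrable function measurable with respect to the family
    (\<open>multiplicative_system_dense\<close>).
\<close>

section \<open>Pairings with linear combinations of words\<close>

lemma pairing_superset:
  assumes "finite A" "Poly_Mapping.keys p \<subseteq> A"
  shows "pairing p T = (\<Sum>w\<in>A. Poly_Mapping.lookup p w * T w)"
  unfolding pairing_def using assms
  by (intro sum.mono_neutral_left) (auto simp: in_keys_iff)

lemma pairing_add: "pairing (p + q) T = pairing p T + pairing q T"
proof -
  let ?A = "Poly_Mapping.keys p \<union> Poly_Mapping.keys q"
  have "Poly_Mapping.keys (p + q) \<subseteq> ?A" by (rule Poly_Mapping.keys_add)
  then show ?thesis
    by (simp add: pairing_superset[of ?A] lookup_add sum.distrib distrib_right)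
qed

lemma pairing_zero [simp]: "pairing 0 T = 0"
  by (simp add: pairing_def)

lemma pairing_single [simp]: "pairing (Poly_Mapping.single w c) T = c * T w"
  by (simp add: pairing_superset[of "{w}"])

lemma lookup_scale [simp]: "Poly_Mapping.lookup (scale c p) w = c * Poly_Mapping.lookup p w"
  by (simp add: scale_def Poly_Mapping.map.rep_eq when_def)

lemma keys_scale: "Poly_Mapping.keys (scale c p) \<subseteq> Poly_Mapping.keys p"
  by (auto simp: in_keys_iff)

lemma pairing_scale: "pairing (scale c p) T = c * pairing p T"
  using keys_scale[of c p]
  by (simp add: pairing_superset[of "Poly_Mapping.keys p"] sum_distrib_left mult.assoc)

lemma pairing_sum: "pairing (\<Sum>i\<in>A. f i) T = (\<Sum>i\<in>A. pairing (f i) T)"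
  by (induction A rule: infinite_finite_induct) (auto simp: pairing_add)

lemma pairing_diff: "pairing (p - q) T = pairing p T - pairing q T"
  using pairing_add[of "p - q" q T] by simp

lemma pairing_prepend: "pairing (prepend a p) T = pairing p (\<lambda>w. T (a # w))"
  by (simp add: prepend_def pairing_sum) (simp add: pairing_def)

section \<open>Linear functionals with geometric growth\<close>

text \<open>
  The coefficient function \<open>a\<close> is an infinite linear combination of words; this is the part of its
  pairing with \<open>T\<close> that belongs to the words of length \<open>k\<close>.
\<close>

definition level_sum :: "('d::finite list \<Rightarrow> real) \<Rightarrow> 'd tseries \<Rightarrow> nat \<Rightarrow> real" where
  "level_sum a T k = (\<Sum>w | length w = k. a w * T w)"

text \<open>
  The whole pairing, summed level by level; it converges absolutely on \<open>entire_tseries\<close> when \<open>a\<close>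
  is \<open>geom_bounded\<close>.
\<close>

definition functional :: "('d::finite list \<Rightarrow> real) \<Rightarrow> 'd tseries \<Rightarrow> real" where
  "functional a T = suminf (level_sum a T)"

text \<open>
  At most geometric growth in the length of the word.
\<close>

definition geom_bounded :: "('d list \<Rightarrow> real) \<Rightarrow> bool" where
  "geom_bounded a \<longleftrightarrow> (\<exists>C r. \<forall>w. \<bar>a w\<bar> \<le> C * r ^ length w)"

lemma geom_boundedE:
  assumes "geom_bounded a"
  obtains C r where "C > 0" "r > 0" "\<And>w. \<bar>a w\<bar> \<le> C * r ^ length w"
proof -
  obtain C r where *: "\<And>w. \<bar>a w\<bar> \<le> C * r ^ length w"
    using assms by (auto simp: geom_bounded_def)
  have "\<bar>a w\<bar> \<le> (\<bar>C\<bar> + 1) * (\<bar>r\<bar> + 1) ^ length w" for w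
  proof -
    have "\<bar>a w\<bar> \<le> \<bar>C * r ^ length w\<bar>" using *[of w] by linarith
    also have "\<dots> = \<bar>C\<bar> * \<bar>r\<bar> ^ length w" by (simp add: abs_mult power_abs)
    also have "\<dots> \<le> (\<bar>C\<bar> + 1) * (\<bar>r\<bar> + 1) ^ length w"
      by (intro mult_mono power_mono) auto
    finally show ?thesis .
  qed
  then show ?thesis using that[of "\<bar>C\<bar> + 1" "\<bar>r\<bar> + 1"] by simp
qed

lemma abs_level_sum_le:
  assumes "\<And>w. \<bar>a w\<bar> \<le> C * r ^ length w"
  shows "\<bar>level_sum a T k\<bar> \<le> C * (r ^ k * proj_norm k T)"
proof -
  have "\<bar>level_sum a T k\<bar> \<le> (\<Sum>w | length w = k. \<bar>a w * T w\<bar>)"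
    unfolding level_sum_def by (rule sum_abs)
  also have "\<dots> \<le> (\<Sum>w | length w = k. C * r ^ k * \<bar>T w\<bar>)"
    using assms by (intro sum_mono) (auto simp: abs_mult intro!: mult_right_mono)
  finally show ?thesis by (simp add: proj_norm_eq sum_distrib_left mult.assoc)
qed

lemma summable_level_sum:
  assumes "T \<in> entire_tseries" "geom_bounded a"
  shows "summable (\<lambda>k. \<bar>level_sum a T k\<bar>)" "summable (level_sum a T)"
proof -
  obtain C r where C: "C > 0" "r > 0" "\<And>w. \<bar>a w\<bar> \<le> C * r ^ length w"
    using assms(2) by (rule geom_boundedE) blast
  have "summable (\<lambda>k. C * (r ^ k * proj_norm k T))"
    using assms(1) C by (intro summable_mult) (auto simp: entire_tseries_def)
  then show "summable (\<lambda>k. \<bar>level_sum a T k\<bar>)"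
    by (rule summable_comparison_test[rotated])
       (use abs_level_sum_le[of a C r T] C in auto)
  then show "summable (level_sum a T)" by (rule summable_rabs_cancel)
qed

text \<open>
  Dual to the shuffle product: the value at \<open>w\<close> is the sum of \<open>a u * b v\<close> over all ways of
  splitting \<open>w\<close> into a subword \<open>u\<close> and the complementary subword \<open>v\<close>.
\<close>

fun deshuffle :: "('d list \<Rightarrow> real) \<Rightarrow> ('d list \<Rightarrow> real) \<Rightarrow> 'd list \<Rightarrow> real" where
  "deshuffle a b [] = a [] * b []"
| "deshuffle a b (c # w) = deshuffle (\<lambda>u. a (c # u)) b w + deshuffle a (\<lambda>v. b (c # v)) w"

text \<open>
  A word of length \<open>n\<close> has \<open>n choose k\<close> splittings into words of length \<open>k\<close> and \<open>n - k\<close>, so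
  the bound is the binomial theorem.
\<close>

lemma deshuffle_bound:
  assumes "\<And>u. \<bar>a u\<bar> \<le> C * r ^ length u" "\<And>v. \<bar>b v\<bar> \<le> D * s ^ length v"
    and "r \<ge> 0" "s \<ge> 0"
  shows "\<bar>deshuffle a b w\<bar> \<le> C * D * (r + s) ^ length w"
  using assms(1,2)
proof (induction w arbitrary: a b C D)
  case Nil
  have "0 \<le> C" using Nil(1)[of "[]"] by simp
  then show ?case using Nil(1)[of "[]"] Nil(2)[of "[]"]
    by (simp add: abs_mult mult_mono)
next
  case (Cons c w)
  have 1: "\<bar>deshuffle (\<lambda>u. a (c # u)) b w\<bar> \<le> (C * r) * D * (r + s) ^ length w"
    using Cons.prems(1)[of "c # _"] Cons.prems(2) by (intro Cons.IH) (auto simp: mult.assoc)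
  have 2: "\<bar>deshuffle a (\<lambda>v. b (c # v)) w\<bar> \<le> C * (D * s) * (r + s) ^ length w"
    using Cons.prems(2)[of "c # _"] Cons.prems(1) by (intro Cons.IH) (auto simp: mult.assoc)
  have "\<bar>deshuffle a b (c # w)\<bar> \<le> (C * r) * D * (r + s) ^ length w + C * (D * s) * (r + s) ^ length w"
    using 1 2 by simp
  also have "\<dots> = C * D * (r + s) ^ length (c # w)" by (simp add: algebra_simps)
  finally show ?case .
qed

lemma geom_bounded_deshuffle:
  assumes "geom_bounded a" "geom_bounded b"
  shows "geom_bounded (deshuffle a b)"
proof -
  obtain C r where 1: "C > 0" "r > 0" "\<And>w. \<bar>a w\<bar> \<le> C * r ^ length w"
    using assms(1) by (rule geom_boundedE) blast
  obtain D s where 2: "D > 0" "s > 0" "\<And>w. \<bar>b w\<bar> \<le> D * s ^ length w"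
    using assms(2) by (rule geom_boundedE) blast
  show ?thesis unfolding geom_bounded_def
    using deshuffle_bound[OF 1(3) 2(3)] 1 2 by (intro exI allI) auto
qed

lemma deshuffle_sum_left:
  "deshuffle (\<lambda>u. \<Sum>q\<in>Q. A q * a q u) b w = (\<Sum>q\<in>Q. A q * deshuffle (a q) b w)"
  by (induction w arbitrary: a b)
     (simp_all add: sum_distrib_right mult.assoc sum.distrib distrib_left)

lemma deshuffle_sum_right:
  "deshuffle a (\<lambda>u. \<Sum>q\<in>Q. A q * b q u) w = (\<Sum>q\<in>Q. A q * deshuffle a (b q) w)"
  by (induction w arbitrary: a b)
     (simp_all add: sum_distrib_left mult.left_commute sum.distrib distrib_left)

abbreviation word_pairs :: "nat \<Rightarrow> ('d list \<times> 'd list) set" where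
  "word_pairs n \<equiv> {(u, v). length u + length v = n}"

lemma finite_word_pairs: "finite (word_pairs n :: ('d::finite list \<times> 'd list) set)"
proof (rule finite_subset)
  show "(word_pairs n :: ('d list \<times> 'd list) set) \<subseteq>
      {w. length w \<le> n} \<times> {w. length w \<le> n}" by auto
  have "finite {w :: 'd list. length w \<le> n}"
    using finite_lists_length_le[of "UNIV :: 'd set" n] by simp
  then show "finite ({w :: 'd list. length w \<le> n} \<times> {w :: 'd list. length w \<le> n})" by simp
qed

lemma pairing_shuffle_rec:
  assumes "u \<noteq> [] \<or> v \<noteq> []"
  shows "pairing (shuffle u v) T =
    (if u = [] then 0 else pairing (shuffle (tl u) v) (\<lambda>w. T (hd u # w))) +
    (if v = [] then 0 else pairing (shuffle u (tl v)) (\<lambda>w. T (hd v # w)))"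
proof -
  have [simp]: "shuffle u [] = word u" for u :: "'a list" by (cases u) auto
  show ?thesis using assms
    by (cases u; cases v) (auto simp: pairing_add pairing_prepend)
qed

text \<open>
  The deshuffling is adjoint to the shuffle product. No assumption on \<open>T\<close> is made, so that the
  induction can pass to the series \<open>w \<mapsto> T (c # w)\<close>.
\<close>

lemma sum_pairing_shuffle:
  "(\<Sum>(u, v)\<in>word_pairs n. a u * b v * pairing (shuffle u v) T) =
   (\<Sum>w | length w = n. deshuffle a b w * T w)"
  for T :: "'d::finite tseries"
proof (induction n arbitrary: a b T)
  case 0
  have "word_pairs 0 = {([] :: 'd list, [] :: 'd list)}" by auto
  then show ?case by simp
next
  case (Suc n)
  let ?P = "word_pairs (Suc n) :: ('d list \<times> 'd list) set"
  let ?Q = "word_pairs n :: ('d list \<times> 'd list) set"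
  let ?L = "\<lambda>u v. a u * b v * pairing (shuffle (tl u) v) (\<lambda>w. T (hd u # w))"
  let ?R = "\<lambda>u v. a u * b v * pairing (shuffle u (tl v)) (\<lambda>w. T (hd v # w))"
  have "(\<Sum>(u, v)\<in>?P. a u * b v * pairing (shuffle u v) T) =
      (\<Sum>(u, v)\<in>?P. (if u = [] then 0 else ?L u v) + (if v = [] then 0 else ?R u v))"
    by (intro sum.cong refl) (auto simp: pairing_shuffle_rec distrib_left)
  also have "\<dots> = (\<Sum>(u, v)\<in>?P. if u = [] then 0 else ?L u v) +
      (\<Sum>(u, v)\<in>?P. if v = [] then 0 else ?R u v)"
    by (simp add: sum.distrib case_prod_unfold)
  also have "(\<Sum>(u, v)\<in>?P. if u = [] then 0 else ?L u v) =
      (\<Sum>(u, v)\<in>{(u, v). (u, v) \<in> ?P \<and> u \<noteq> []}. ?L u v)"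
    using finite_word_pairs by (intro sum.mono_neutral_cong_right) auto
  also have "\<dots> = (\<Sum>(c, (u, v))\<in>UNIV \<times> ?Q.
      a (c # u) * b v * pairing (shuffle u v) (\<lambda>w. T (c # w)))"
    by (rule sum.reindex_bij_witness[where i = "\<lambda>(c, u, v). (c # u, v)"
          and j = "\<lambda>(u, v). (hd u, tl u, v)"]) (auto simp: neq_Nil_conv)
  also have "\<dots> = (\<Sum>c\<in>UNIV. \<Sum>w | length w = n. deshuffle (\<lambda>u. a (c # u)) b w * T (c # w))"
    by (simp only: sum.cartesian_product[symmetric] Suc.IH)
  also have "(\<Sum>(u, v)\<in>?P. if v = [] then 0 else ?R u v) =
      (\<Sum>(u, v)\<in>{(u, v). (u, v) \<in> ?P \<and> v \<noteq> []}. ?R u v)"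
    using finite_word_pairs by (intro sum.mono_neutral_cong_right) auto
  also have "\<dots> = (\<Sum>(c, (u, v))\<in>UNIV \<times> ?Q.
      a u * b (c # v) * pairing (shuffle u v) (\<lambda>w. T (c # w)))"
    by (rule sum.reindex_bij_witness[where i = "\<lambda>(c, u, v). (u, c # v)"
          and j = "\<lambda>(u, v). (hd v, u, tl v)"]) (auto simp: neq_Nil_conv)
  also have "\<dots> = (\<Sum>c\<in>UNIV. \<Sum>w | length w = n. deshuffle a (\<lambda>v. b (c # v)) w * T (c # w))"
    by (simp only: sum.cartesian_product[symmetric] Suc.IH)
  finally show ?case
    by (simp add: sum_words_Suc sum.distrib distrib_right)
qed

lemma functional_mult:
  assumes "T \<in> grouplike" "geom_bounded a" "geom_bounded b"
  shows "functional a T * functional b T = functional (deshuffle a b) T"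
proof -
  have T: "T \<in> entire_tseries" using assms(1) by (simp add: grouplike_def)
  have mult: "T u * T v = pairing (shuffle u v) T" for u v
    using assms(1) by (simp add: grouplike_def)
  have "(\<Sum>i\<le>n. level_sum a T i * level_sum b T (n - i)) = level_sum (deshuffle a b) T n" for n
  proof -
    have fin: "finite {w :: 'a list. length w = k}" for k by (rule finite_words)
    have "(\<Sum>i\<le>n. level_sum a T i * level_sum b T (n - i)) =
        (\<Sum>i\<le>n. \<Sum>(u, v)\<in>{u. length u = i} \<times> {v. length v = n - i}. (a u * T u) * (b v * T v))"
      by (simp add: level_sum_def sum_product sum.cartesian_product)
    also have "\<dots> = (\<Sum>(u, v)\<in>word_pairs n. (a u * T u) * (b v * T v))"
      by (subst sum.Sigma)
         (auto intro!: sum.reindex_bij_witness[where i = "\<lambda>(u, v). (length u, u, v)" and j = snd]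
           simp: fin)
    also have "\<dots> = (\<Sum>(u, v)\<in>word_pairs n. a u * b v * pairing (shuffle u v) T)"
      by (intro sum.cong refl) (auto simp flip: mult)
    finally show ?thesis by (simp add: sum_pairing_shuffle level_sum_def)
  qed
  then show ?thesis unfolding functional_def
    using Cauchy_product[of "level_sum a T" "level_sum b T"] summable_level_sum[OF T] assms
    by simp
qed

section \<open>Matrix coefficients of orthogonal representations\<close>

text \<open>
  The vertices \<open>0, \<dots>, length w\<close> form a path, whose edge from \<open>j\<close> to \<open>Suc j\<close> carries the letter
  \<open>w ! j\<close>. The letter \<open>c\<close> is sent to the skew-symmetric adjacency matrix of the edges that carry it.
\<close>

definition path_matrix :: "'d list \<Rightarrow> 'd \<Rightarrow> nat \<Rightarrow> nat \<Rightarrow> real" where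
  "path_matrix w c p q = of_bool (q = Suc p \<and> p < length w \<and> w ! p = c)
     - of_bool (p = Suc q \<and> q < length w \<and> w ! q = c)"

text \<open>
  The entry in row \<open>p\<close> and the last column of the product along a word of the matrices of its
  letters, each scaled by \<open>e\<close>. As a functional of a group-like series this is an entry of an
  orthogonal matrix.
\<close>

fun path_coeff :: "'d list \<Rightarrow> real \<Rightarrow> nat \<Rightarrow> 'd list \<Rightarrow> real" where
  "path_coeff w e p [] = of_bool (p = length w)"
| "path_coeff w e p (c # v) = (\<Sum>q\<le>length w. e * path_matrix w c p q * path_coeff w e q v)"

lemma path_matrix_skew: "path_matrix w c q p = - path_matrix w c p q"
  by (simp add: path_matrix_def)

lemma geom_bounded_path_coeff: "geom_bounded (path_coeff w e p)"
proof -
  have "\<bar>path_coeff w e p v\<bar> \<le> 1 * (real (Suc (length w)) * \<bar>e\<bar>) ^ length v" for v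
  proof (induction v arbitrary: p)
    case (Cons c v)
    have "\<bar>path_coeff w e p (c # v)\<bar> \<le>
        (\<Sum>q\<le>length w. \<bar>e * path_matrix w c p q * path_coeff w e q v\<bar>)"
      by (simp only: path_coeff.simps sum_abs)
    also have "\<dots> \<le> (\<Sum>q\<le>length w. \<bar>e\<bar> * 1 * (real (Suc (length w)) * \<bar>e\<bar>) ^ length v)"
      unfolding abs_mult using Cons.IH
      by (intro sum_mono mult_mono) (auto simp: path_matrix_def)
    finally show ?case by (simp add: mult_ac)
  qed auto
  then show ?thesis unfolding geom_bounded_def by blast
qed

text \<open>
  Orthogonality of the representation, on coefficients: splitting off the first letter \<open>c\<close> of a
  nonempty word produces \<open>\<langle>A\<^sub>c x, y\<rangle> + \<langle>x, A\<^sub>c y\<rangle>\<close>, which vanishes since \<open>A\<^sub>c\<close> is skew.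
\<close>

lemma sum_deshuffle_path_coeff:
  "(\<Sum>p\<le>length w. deshuffle (path_coeff w e p) (path_coeff w e p) v) = of_bool (v = [])"
proof (cases v)
  case Nil
  have "(\<Sum>p\<le>length w. deshuffle (path_coeff w e p) (path_coeff w e p) []) =
      (\<Sum>p\<le>length w. if p = length w then 1 else 0)"
    by (intro sum.cong) auto
  then show ?thesis by (simp add: Nil)
next
  case (Cons c v')
  let ?A = "path_matrix w c" and ?y = "path_coeff w e"
  let ?I = "{..length w}"
  have "(\<Sum>p\<in>?I. deshuffle (?y p) (?y p) v) =
      (\<Sum>p\<in>?I. \<Sum>q\<in>?I. e * ?A p q * deshuffle (?y q) (?y p) v') +
      (\<Sum>p\<in>?I. \<Sum>q\<in>?I. e * ?A p q * deshuffle (?y p) (?y q) v')"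
    by (simp add: Cons deshuffle_sum_left deshuffle_sum_right sum.distrib)
  also have "(\<Sum>p\<in>?I. \<Sum>q\<in>?I. e * ?A p q * deshuffle (?y p) (?y q) v') =
      (\<Sum>p\<in>?I. \<Sum>q\<in>?I. e * ?A q p * deshuffle (?y q) (?y p) v')"
    by (rule sum.swap)
  also have "\<dots> = - (\<Sum>p\<in>?I. \<Sum>q\<in>?I. e * ?A p q * deshuffle (?y q) (?y p) v')"
    by (subst path_matrix_skew) (simp add: sum_negf)
  finally show ?thesis by (simp add: Cons)
qed

lemma functional_unit: "functional (\<lambda>v. of_bool (v = [])) T = T []"
proof -
  have "level_sum (\<lambda>v. of_bool (v = [])) T = (\<lambda>k. if k = 0 then T [] else 0)"
  proof
    show "level_sum (\<lambda>v. of_bool (v = [])) T k = (if k = 0 then T [] else 0)" for k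
      by (cases k) (auto simp: level_sum_def intro!: sum.neutral)
  qed
  then show ?thesis unfolding functional_def
    using sums_single[of 0 "\<lambda>_. T []"] by (simp add: sums_iff)
qed

lemma functional_sum:
  assumes "T \<in> entire_tseries" "\<And>i. i \<in> I \<Longrightarrow> geom_bounded (a i)"
  shows "functional (\<lambda>w. \<Sum>i\<in>I. a i w) T = (\<Sum>i\<in>I. functional (a i) T)"
proof -
  have "level_sum (\<lambda>w. \<Sum>i\<in>I. a i w) T = (\<lambda>k. \<Sum>i\<in>I. level_sum (a i) T k)"
    by (simp add: level_sum_def sum_distrib_right fun_eq_iff) (intro allI sum.swap)
  then show ?thesis unfolding functional_def
    using assms by (simp add: suminf_sum summable_level_sum)
qed

text \<open>
  The matrix coefficients of the last column are the coordinates of a unit vector.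
\<close>

lemma functional_path_coeff_le_1:
  assumes "T \<in> grouplike" "p \<le> length w"
  shows "\<bar>functional (path_coeff w e p) T\<bar> \<le> 1"
proof -
  have T: "T \<in> entire_tseries" "T [] = 1" using assms by (auto simp: grouplike_def)
  have "(\<Sum>p\<le>length w. (functional (path_coeff w e p) T)\<^sup>2) =
      functional (\<lambda>v. \<Sum>p\<le>length w. deshuffle (path_coeff w e p) (path_coeff w e p) v) T"
    using assms T
    by (simp add: functional_mult functional_sum geom_bounded_path_coeff geom_bounded_deshuffle
        power2_eq_square)
  also have "\<dots> = 1" by (simp only: sum_deshuffle_path_coeff functional_unit T)
  finally have "(functional (path_coeff w e p) T)\<^sup>2 \<le> 1"
    using member_le_sum[of p "{..length w}" "\<lambda>p. (functional (path_coeff w e p) T)\<^sup>2"] assms(2)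
    by simp
  then show ?thesis by (simp add: abs_square_le_1)
qed

lemma path_coeff_scale: "path_coeff w e p v = e ^ length v * path_coeff w 1 p v"
  by (induction v arbitrary: p) (auto simp: sum_distrib_left mult_ac intro!: sum.cong)

lemma path_coeff_short: "p + length v < length w \<Longrightarrow> path_coeff w e p v = 0"
  by (induction v arbitrary: p) (auto simp: path_matrix_def intro!: sum.neutral)

text \<open>
  From \<open>p\<close>, the other end of the path is reached in the minimal number of steps only by moving
  forward at each of them, so the word must spell the remaining edges.
\<close>

lemma path_coeff_drop:
  "p + length v = length w \<Longrightarrow> path_coeff w 1 p v = of_bool (v = drop p w)"
proof (induction v arbitrary: p)
  case (Cons c v)
  have "path_coeff w 1 p (c # v) =
      (\<Sum>q\<le>length w. of_bool (q = Suc p) * (of_bool (w ! p = c) * path_coeff w 1 (Suc p) v))"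
    unfolding path_coeff.simps
  proof (rule sum.cong)
    fix q assume "q \<in> {..length w}"
    show "1 * path_matrix w c p q * path_coeff w 1 q v =
        of_bool (q = Suc p) * (of_bool (w ! p = c) * path_coeff w 1 (Suc p) v)"
      using Cons.prems path_coeff_short[of q v w 1] by (auto simp: path_matrix_def)
  qed simp
  also have "\<dots> = of_bool (w ! p = c) * path_coeff w 1 (Suc p) v"
    using Cons.prems by (simp flip: sum_distrib_right add: of_bool_def)
  also have "\<dots> = of_bool (c # v = drop p w)"
  proof -
    have "drop p w = w ! p # drop (Suc p) w"
      using Cons.prems by (simp add: Cons_nth_drop_Suc)
    then show ?thesis using Cons.prems Cons.IH[of "Suc p"] by auto
  qed
  finally show ?case .
qed simp

text \<open>
  As a function of \<open>e\<close> the matrix entry between the ends of the path is a power series without terms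
  of degree below \<open>length w\<close>, and its coefficient of that degree is \<open>T w\<close>.
\<close>

lemma functional_path_coeff_tendsto:
  assumes "T \<in> entire_tseries"
  shows "(\<lambda>n. real (Suc n) ^ length w * functional (path_coeff w (1 / real (Suc n)) 0) T)
    \<longlonglongrightarrow> T w"
proof -
  let ?k = "length w"
  define c where "c = level_sum (path_coeff w 1 0) T"
  have lev: "level_sum (path_coeff w e 0) T = (\<lambda>m. c m * e ^ m)" for e
    unfolding c_def level_sum_def sum_distrib_right
    by (intro ext sum.cong refl, subst path_coeff_scale) auto
  have c0: "c m = 0" if "m < ?k" for m
    using that unfolding c_def level_sum_def
    by (intro sum.neutral) (auto simp: path_coeff_short)
  have ck: "c ?k = T w"
  proof -
    have "c ?k = (\<Sum>v | length v = ?k. if v = w then T v else 0)"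
      unfolding c_def level_sum_def by (intro sum.cong) (auto simp: path_coeff_drop)
    then show ?thesis by (simp add: finite_words)
  qed
  have summ: "summable (\<lambda>m. c m * e ^ m)" for e
    using summable_level_sum(2)[OF assms geom_bounded_path_coeff, of w e 0] by (simp add: lev)
  define g where "g e = suminf (\<lambda>m. c (m + ?k) * e ^ m)" for e
  have ksum: "(\<lambda>m. c (m + ?k) * e ^ m) sums g e" for e
  proof (cases "e = 0")
    case True
    then show ?thesis unfolding g_def using powser_sums_zero[of "\<lambda>m. c (m + ?k)"] sums_summable
      by (simp add: summable_sums)
  next
    case False
    have "summable (\<lambda>m. c (m + ?k) * e ^ (m + ?k))"
      using summ[of e] summable_iff_shift[of "\<lambda>m. c m * e ^ m" ?k] by simp
    then have "summable (\<lambda>m. c (m + ?k) * e ^ (m + ?k) / e ^ ?k)" by (rule summable_divide)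
    then show ?thesis unfolding g_def using False by (simp add: power_add summable_sums)
  qed
  have fg: "functional (path_coeff w e 0) T = e ^ ?k * g e" for e
  proof -
    have "functional (path_coeff w e 0) T = suminf (\<lambda>m. c m * e ^ m)"
      unfolding functional_def by (simp add: lev)
    also have "\<dots> = suminf (\<lambda>m. c (m + ?k) * e ^ (m + ?k))"
      using suminf_minus_initial_segment[OF summ, of ?k e] c0 by simp
    also have "\<dots> = suminf (\<lambda>m. e ^ ?k * (c (m + ?k) * e ^ m))"
      by (simp add: power_add mult_ac)
    also have "\<dots> = e ^ ?k * g e" unfolding g_def
      by (rule suminf_mult) (use ksum in \<open>auto simp: sums_iff\<close>)
    finally show ?thesis .
  qed
  have "(g \<longlongrightarrow> T w) (at 0)"
    using powser_limit_0[of 1 "\<lambda>m. c (m + ?k)" g] ksum ck by simp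
  moreover have "filterlim (\<lambda>n. 1 / real (Suc n)) (at 0) sequentially"
    unfolding filterlim_at
    using LIMSEQ_inverse_real_of_nat by (auto simp: inverse_eq_divide)
  ultimately have "(\<lambda>n. g (1 / real (Suc n))) \<longlonglongrightarrow> T w"
    by (rule filterlim_compose)
  moreover have "real (Suc n) ^ ?k * functional (path_coeff w (1 / real (Suc n)) 0) T =
      g (1 / real (Suc n))" for n
    unfolding fg by (simp add: power_divide)
  ultimately show ?thesis by simp
qed

section \<open>Closed subspaces of square integrable functions\<close>

lemma L2_measurable: "f \<in> L2 M N \<Longrightarrow> f \<in> borel_measurable N"
  by (simp add: L2_def)

lemma L2_integrable_square: "f \<in> L2 M N \<Longrightarrow> integrable M (\<lambda>x. (f x)\<^sup>2)"
  by (simp add: L2_def)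

lemma L2_integrable_mult:
  assumes "f \<in> L2 M M" "g \<in> L2 M M"
  shows "integrable M (\<lambda>x. f x * g x)"
proof (rule Bochner_Integration.integrable_bound)
  show "integrable M (\<lambda>x. (f x)\<^sup>2 + (g x)\<^sup>2)"
    using assms by (auto simp: L2_def)
  show "(\<lambda>x. f x * g x) \<in> borel_measurable M"
    using assms by (auto simp: L2_def)
  have "\<bar>a * b\<bar> \<le> a\<^sup>2 + b\<^sup>2" for a b :: real
  proof -
    have "2 * \<bar>a * b\<bar> \<le> a\<^sup>2 + b\<^sup>2"
      using sum_squares_bound[of "\<bar>a\<bar>" "\<bar>b\<bar>"] by (simp add: abs_mult mult.assoc)
    then show ?thesis by linarith
  qed
  then show "AE x in M. norm (f x * g x) \<le> norm ((f x)\<^sup>2 + (g x)\<^sup>2)" by auto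
qed

lemma L2_bound:
  assumes "f \<in> borel_measurable M" "g \<in> L2 M M" "\<And>x. x \<in> space M \<Longrightarrow> \<bar>f x\<bar> \<le> \<bar>g x\<bar>"
  shows "f \<in> L2 M M"
  unfolding L2_def
proof (intro CollectI conjI)
  show "integrable M (\<lambda>x. (f x)\<^sup>2)"
    by (rule Bochner_Integration.integrable_bound[of M "\<lambda>x. (g x)\<^sup>2"])
       (use assms in \<open>auto simp: L2_def abs_le_square_iff intro!: AE_I2\<close>)
qed (use assms in auto)

lemma L2_add: "f \<in> L2 M M \<Longrightarrow> g \<in> L2 M M \<Longrightarrow> (\<lambda>x. f x + g x) \<in> L2 M M"
  using L2_integrable_mult[of f M g]
  by (auto simp: L2_def power2_sum mult.assoc)

lemma L2_scale: "f \<in> L2 M M \<Longrightarrow> (\<lambda>x. c * f x) \<in> L2 M M"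
  by (auto simp: L2_def power_mult_distrib)

lemma L2_diff: "f \<in> L2 M M \<Longrightarrow> g \<in> L2 M M \<Longrightarrow> (\<lambda>x. f x - g x) \<in> L2 M M"
  using L2_add[of f M "\<lambda>x. -1 * g x"] L2_scale[of g M "-1"] by simp

lemma L2_zero: "(\<lambda>x. 0) \<in> L2 M N"
  by (simp add: L2_def)

lemma L2_sum: "(\<And>i. i \<in> I \<Longrightarrow> f i \<in> L2 M M) \<Longrightarrow> (\<lambda>x. \<Sum>i\<in>I. f i x) \<in> L2 M M"
  by (induction I rule: infinite_finite_induct) (auto simp: L2_zero L2_add)

lemma (in finite_measure) L2_bounded:
  assumes "f \<in> borel_measurable M" "\<And>x. x \<in> space M \<Longrightarrow> \<bar>f x\<bar> \<le> B"
  shows "f \<in> L2 M M"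
proof (rule L2_bound[OF assms(1)])
  show "(\<lambda>x. B) \<in> L2 M M" by (simp add: L2_def)
  show "\<bar>f x\<bar> \<le> \<bar>B\<bar>" if "x \<in> space M" for x using assms(2)[OF that] by simp
qed

lemma integral_square_add_le:
  assumes "f \<in> L2 M M" "g \<in> L2 M M"
  shows "(\<integral>x. (f x + g x)\<^sup>2 \<partial>M) \<le> 2 * (\<integral>x. (f x)\<^sup>2 \<partial>M) + 2 * (\<integral>x. (g x)\<^sup>2 \<partial>M)"
proof -
  have "(\<integral>x. (f x + g x)\<^sup>2 \<partial>M) \<le> (\<integral>x. 2 * (f x)\<^sup>2 + 2 * (g x)\<^sup>2 \<partial>M)"
  proof (rule integral_mono)
    show "integrable M (\<lambda>x. (f x + g x)\<^sup>2)"
      using L2_add[OF assms] by (simp add: L2_def)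
    show "integrable M (\<lambda>x. 2 * (f x)\<^sup>2 + 2 * (g x)\<^sup>2)"
      using assms by (auto simp: L2_def)
    show "(f x + g x)\<^sup>2 \<le> 2 * (f x)\<^sup>2 + 2 * (g x)\<^sup>2" for x
      using sum_squares_bound[of "f x" "g x"] by (simp add: power2_sum)
  qed
  also have "\<dots> = 2 * (\<integral>x. (f x)\<^sup>2 \<partial>M) + 2 * (\<integral>x. (g x)\<^sup>2 \<partial>M)"
    using assms by (simp add: L2_def)
  finally show ?thesis .
qed

text \<open>Those square integrable functions that are limits in mean square of elements of \<open>W\<close>.\<close>

definition L2_closure :: "'a measure \<Rightarrow> ('a \<Rightarrow> real) set \<Rightarrow> ('a \<Rightarrow> real) set" where
  "L2_closure M W = {h \<in> L2 M M. \<forall>e>0. \<exists>u\<in>W. (\<integral>x. (h x - u x)\<^sup>2 \<partial>M) < e}"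

text \<open>
  The linear subspace \<open>W\<close> consists of functions, not of classes modulo null sets, and need not be
  closed.
\<close>

locale L2_subspace = finite_measure M for M :: "'a measure" +
  fixes W :: "('a \<Rightarrow> real) set"
  assumes subspace_L2: "W \<subseteq> L2 M M"
    and subspace_zero: "(\<lambda>x. 0) \<in> W"
    and subspace_add: "f \<in> W \<Longrightarrow> g \<in> W \<Longrightarrow> (\<lambda>x. f x + g x) \<in> W"
    and subspace_scale: "f \<in> W \<Longrightarrow> (\<lambda>x. c * f x) \<in> W"
begin

lemma closure_L2: "h \<in> L2_closure M W \<Longrightarrow> h \<in> L2 M M"
  by (simp add: L2_closure_def)

lemma closure_closed:
  assumes "h \<in> L2 M M" "\<And>e. e > 0 \<Longrightarrow> \<exists>g\<in>L2_closure M W. (\<integral>x. (h x - g x)\<^sup>2 \<partial>M) < e"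
  shows "h \<in> L2_closure M W"
  unfolding L2_closure_def
proof (intro CollectI conjI allI impI)
  fix e :: real assume "e > 0"
  obtain g where g: "g \<in> L2_closure M W" "(\<integral>x. (h x - g x)\<^sup>2 \<partial>M) < e / 4"
    using assms(2)[of "e / 4"] \<open>e > 0\<close> by auto
  obtain u where u: "u \<in> W" "(\<integral>x. (g x - u x)\<^sup>2 \<partial>M) < e / 4"
    using g(1) \<open>e > 0\<close> unfolding L2_closure_def by (auto dest: spec[of _ "e / 4"])
  have L: "(\<lambda>x. h x - g x) \<in> L2 M M" "(\<lambda>x. g x - u x) \<in> L2 M M"
    using assms(1) closure_L2[OF g(1)] u(1) subspace_L2 by (auto intro: L2_diff)
  have "(\<integral>x. (h x - u x)\<^sup>2 \<partial>M) < e"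
    using integral_square_add_le[OF L] g(2) u(2) by simp
  with u(1) show "\<exists>u\<in>W. (\<integral>x. (h x - u x)\<^sup>2 \<partial>M) < e" by blast
qed fact

lemma closure_incl: "W \<subseteq> L2_closure M W"
proof
  fix u assume u: "u \<in> W"
  have "(\<integral>x. (u x - u x)\<^sup>2 \<partial>M) < e" if "e > 0" for e using that by simp
  then show "u \<in> L2_closure M W"
    using u subspace_L2 unfolding L2_closure_def by blast
qed

lemma closure_cong:
  assumes "h \<in> L2_closure M W" "\<And>x. x \<in> space M \<Longrightarrow> h x = h' x"
  shows "h' \<in> L2_closure M W"
proof -
  have "(\<integral>x. (h' x - u x)\<^sup>2 \<partial>M) = (\<integral>x. (h x - u x)\<^sup>2 \<partial>M)" for u
    using assms(2) by (intro Bochner_Integration.integral_cong) auto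
  moreover have "h' \<in> L2 M M"
    by (rule L2_bound[where g = h])
       (use assms closure_L2[OF assms(1)] in \<open>auto simp: L2_def cong: measurable_cong\<close>)
  ultimately show ?thesis using assms(1) by (simp add: L2_closure_def)
qed

lemma closure_add:
  assumes "f \<in> L2_closure M W" "g \<in> L2_closure M W"
  shows "(\<lambda>x. f x + g x) \<in> L2_closure M W"
  unfolding L2_closure_def
proof (intro CollectI conjI allI impI)
  show "(\<lambda>x. f x + g x) \<in> L2 M M" using assms by (auto intro: L2_add closure_L2)
  fix e :: real assume "e > 0"
  obtain u where u: "u \<in> W" "(\<integral>x. (f x - u x)\<^sup>2 \<partial>M) < e / 4"
    using assms(1) \<open>e > 0\<close> unfolding L2_closure_def by (auto dest: spec[of _ "e / 4"])
  obtain v where v: "v \<in> W" "(\<integral>x. (g x - v x)\<^sup>2 \<partial>M) < e / 4"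
    using assms(2) \<open>e > 0\<close> unfolding L2_closure_def by (auto dest: spec[of _ "e / 4"])
  have L: "(\<lambda>x. f x - u x) \<in> L2 M M" "(\<lambda>x. g x - v x) \<in> L2 M M"
    using closure_L2 assms u(1) v(1) subspace_L2 by (auto intro: L2_diff)
  have "(\<integral>x. (f x + g x - (u x + v x))\<^sup>2 \<partial>M) < e"
    using integral_square_add_le[OF L] u(2) v(2) by (simp add: algebra_simps)
  then show "\<exists>u\<in>W. (\<integral>x. (f x + g x - u x)\<^sup>2 \<partial>M) < e"
    using subspace_add[OF u(1) v(1)] by (intro bexI[of _ "\<lambda>x. u x + v x"]) auto
qed

lemma closure_scale:
  assumes "f \<in> L2_closure M W"
  shows "(\<lambda>x. c * f x) \<in> L2_closure M W"
  unfolding L2_closure_def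
proof (intro CollectI conjI allI impI)
  show "(\<lambda>x. c * f x) \<in> L2 M M" using assms by (auto intro: L2_scale closure_L2)
  fix e :: real assume "e > 0"
  then have "e / (c\<^sup>2 + 1) > 0" by (simp add: add_nonneg_pos)
  then obtain u where u: "u \<in> W" "(\<integral>x. (f x - u x)\<^sup>2 \<partial>M) < e / (c\<^sup>2 + 1)"
    using assms unfolding L2_closure_def by blast
  have "(\<integral>x. (c * f x - c * u x)\<^sup>2 \<partial>M) = c\<^sup>2 * (\<integral>x. (f x - u x)\<^sup>2 \<partial>M)"
    by (simp flip: right_diff_distrib add: power_mult_distrib)
  also have "\<dots> \<le> c\<^sup>2 * (e / (c\<^sup>2 + 1))" using u(2) by (intro mult_left_mono) auto
  also have "\<dots> < e" using \<open>e > 0\<close> by (simp add: divide_simps add_nonneg_pos)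
  finally show "\<exists>u\<in>W. (\<integral>x. (c * f x - u x)\<^sup>2 \<partial>M) < e"
    using subspace_scale[OF u(1)] by (intro bexI[of _ "\<lambda>x. c * u x"]) auto
qed

lemma closure_sum:
  "(\<And>i. i \<in> I \<Longrightarrow> f i \<in> L2_closure M W) \<Longrightarrow> (\<lambda>x. \<Sum>i\<in>I. f i x) \<in> L2_closure M W"
  using subspace_zero closure_incl
  by (induction I rule: infinite_finite_induct) (auto simp: closure_add)

lemma closure_dominated:
  fixes g :: "nat \<Rightarrow> 'a \<Rightarrow> real"
  assumes g: "\<And>n. g n \<in> L2_closure M W"
    and lim: "\<And>x. x \<in> space M \<Longrightarrow> (\<lambda>n. g n x) \<longlonglongrightarrow> h x"
    and dom: "D \<in> L2 M M" "\<And>n x. x \<in> space M \<Longrightarrow> \<bar>g n x\<bar> \<le> D x"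
  shows "h \<in> L2_closure M W"
proof -
  have gm [measurable]: "g n \<in> borel_measurable M" for n
    using closure_L2[OF g] by (rule L2_measurable)
  have hm [measurable]: "h \<in> borel_measurable M"
    by (rule borel_measurable_LIMSEQ_real[OF lim gm])
  have hD: "\<bar>h x\<bar> \<le> D x" if "x \<in> space M" for x
    by (rule LIMSEQ_le_const2[OF tendsto_rabs[OF lim[OF that]]]) (use dom(2) that in auto)
  have h: "h \<in> L2 M M"
    by (rule L2_bound[OF hm dom(1)]) (use hD in fastforce)
  have "(\<lambda>n. \<integral>x. (h x - g n x)\<^sup>2 \<partial>M) \<longlonglongrightarrow> (\<integral>x. 0 \<partial>M)"
  proof (rule integral_dominated_convergence[where w = "\<lambda>x. (2 * D x)\<^sup>2"])
    show "integrable M (\<lambda>x. (2 * D x)\<^sup>2)"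
      using L2_scale[OF dom(1)] by (rule L2_integrable_square)
    show "AE x in M. (\<lambda>n. (h x - g n x)\<^sup>2) \<longlonglongrightarrow> 0"
    proof (rule AE_I2)
      fix x assume "x \<in> space M"
      from tendsto_power[OF tendsto_diff[OF tendsto_const lim[OF this]], of "h x" 2]
      show "(\<lambda>n. (h x - g n x)\<^sup>2) \<longlonglongrightarrow> 0" by simp
    qed
    show "AE x in M. norm ((h x - g n x)\<^sup>2) \<le> (2 * D x)\<^sup>2" for n
    proof (rule AE_I2)
      fix x assume "x \<in> space M"
      then have "\<bar>h x - g n x\<bar> \<le> \<bar>2 * D x\<bar>" using dom(2)[of x n] hD[of x] by linarith
      then show "norm ((h x - g n x)\<^sup>2) \<le> (2 * D x)\<^sup>2" by (simp add: abs_le_square_iff)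
    qed
  qed auto
  then have lim0: "(\<lambda>n. \<integral>x. (h x - g n x)\<^sup>2 \<partial>M) \<longlonglongrightarrow> 0" by simp
  show ?thesis
  proof (rule closure_closed[OF h])
    fix e :: real assume "e > 0"
    then obtain n where "(\<integral>x. (h x - g n x)\<^sup>2 \<partial>M) < e"
      using order_tendstoD(2)[OF lim0] by (auto simp: eventually_sequentially)
    with g show "\<exists>g\<in>L2_closure M W. (\<integral>x. (h x - g x)\<^sup>2 \<partial>M) < e" by blast
  qed
qed

end

section \<open>A multiplicative system theorem\<close>

text \<open>
  On \<open>[-1, 1]\<close> the indicator function of \<open>(c, \<infinity>)\<close> is a bounded pointwise limit of continuous
  functions, and these are uniform limits of polynomials by Weierstrass.
\<close>

lemma real_polynomials_to_step:
  fixes c :: real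
  obtains p :: "nat \<Rightarrow> real \<Rightarrow> real" where
    "\<And>n. real_polynomial_function (p n)"
    "\<And>n t. \<bar>t\<bar> \<le> 1 \<Longrightarrow> \<bar>p n t\<bar> \<le> 2"
    "\<And>t. \<bar>t\<bar> \<le> 1 \<Longrightarrow> (\<lambda>n. p n t) \<longlonglongrightarrow> of_bool (t > c)"
proof -
  define \<phi> where "\<phi> n t = min 1 (max 0 (real n * (t - c)))" for n t
  \<comment> \<open>The polynomial for \<open>\<phi> n\<close> is taken within \<open>1 / Suc n\<close>, which keeps it below 2.\<close>
  have "\<exists>p. real_polynomial_function p \<and> (\<forall>t\<in>{-1..1}. \<bar>\<phi> n t - p t\<bar> < inverse (real (Suc n)))" for n
  proof -
    have "continuous_on {-1..1} (\<phi> n)" unfolding \<phi>_def by (intro continuous_intros)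
    then show ?thesis
      using Stone_Weierstrass_real_polynomial_function[of "{-1..1}" "\<phi> n" "inverse (real (Suc n))"]
      by (metis compact_Icc inverse_positive_iff_positive of_nat_0_less_iff zero_less_Suc)
  qed
  then obtain p where p: "\<And>n. real_polynomial_function (p n)"
      "\<And>n t. \<bar>t\<bar> \<le> 1 \<Longrightarrow> \<bar>\<phi> n t - p n t\<bar> < inverse (real (Suc n))"
    by (metis abs_le_iff atLeastAtMost_iff minus_le_iff)
  show ?thesis
  proof (rule that[of p])
    show "real_polynomial_function (p n)" for n by (rule p)
    show "\<bar>p n t\<bar> \<le> 2" if "\<bar>t\<bar> \<le> 1" for n t
    proof -
      have "\<bar>\<phi> n t\<bar> \<le> 1" by (auto simp: \<phi>_def)
      moreover have "inverse (real (Suc n)) \<le> 1" by (simp add: inverse_eq_divide)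
      ultimately show ?thesis using p(2)[OF that, of n] by linarith
    qed
    show "(\<lambda>n. p n t) \<longlonglongrightarrow> of_bool (t > c)" if t: "\<bar>t\<bar> \<le> 1" for t
    proof -
      have "(\<lambda>n. \<phi> n t) \<longlonglongrightarrow> of_bool (t > c)"
      proof (cases "t > c")
        case True
        obtain N where N: "real N > 1 / (t - c)" using reals_Archimedean2 by blast
        have "\<phi> n t = 1" if "n \<ge> N" for n
        proof -
          have "1 / (t - c) \<le> real n" using N that by linarith
          then have "1 \<le> real n * (t - c)" using True by (simp add: pos_divide_le_eq)
          then show ?thesis by (simp add: \<phi>_def)
        qed
        then have "\<forall>\<^sub>F n in sequentially. \<phi> n t = of_bool (t > c)"
          using True by (auto simp: eventually_sequentially)
        then show ?thesis by (rule tendsto_eventually)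
      next
        case False
        then have "\<phi> n t = 0" for n by (simp add: \<phi>_def mult_nonneg_nonpos)
        then show ?thesis using False by simp
      qed
      moreover have "(\<lambda>n. \<phi> n t - p n t) \<longlonglongrightarrow> 0"
        by (rule tendsto_0_le[OF LIMSEQ_inverse_real_of_nat, of _ 1])
           (use p(2)[OF t] in \<open>auto intro!: always_eventually less_imp_le\<close>)
      ultimately have "(\<lambda>n. \<phi> n t - (\<phi> n t - p n t)) \<longlonglongrightarrow> of_bool (t > c) - 0"
        by (rule tendsto_diff)
      then show ?thesis by simp
    qed
  qed
qed

text \<open>
  The preimages of boxes, unbounded above, under finitely many functions of \<open>F\<close>. They form a
  generator of the \<open>\<sigma>\<close>-algebra of \<open>F\<close> that is stable under intersections.
\<close>

definition boxes :: "'a measure \<Rightarrow> ('a \<Rightarrow> real) set \<Rightarrow> 'a set set" where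
  "boxes M F = {{x \<in> space M. \<forall>(f, c)\<in>set B. f x > c} | B. set B \<subseteq> F \<times> UNIV}"

context L2_subspace begin

context
  fixes F :: "('a \<Rightarrow> real) set"
  assumes F_bounded: "\<And>f x. f \<in> F \<Longrightarrow> x \<in> space M \<Longrightarrow> \<bar>f x\<bar> \<le> 1"
    and F_measurable: "\<And>f. f \<in> F \<Longrightarrow> f \<in> borel_measurable M"
    and monomials: "\<And>L. set L \<subseteq> F \<Longrightarrow> (\<lambda>x. prod_list (map (\<lambda>f. f x) L)) \<in> L2_closure M W"
begin

text \<open>
  Each further indicator function is reached through polynomials in the corresponding \<open>f\<close>. They
  turn monomials into combinations of monomials, which is why the monomial factor is carried along.
\<close>

lemma closure_box_times_monomial:
  assumes "set B \<subseteq> F \<times> UNIV" "set L \<subseteq> F"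
  shows "(\<lambda>x. of_bool (\<forall>(f, c)\<in>set B. f x > c) * (prod_list (map (\<lambda>f. f x) L))) \<in> L2_closure M W"
  using assms
proof (induction B arbitrary: L)
  case Nil
  then show ?case using monomials by simp
next
  case (Cons y B)
  obtain f c where y: "y = (f, c)" by force
  have f: "f \<in> F" and B: "set B \<subseteq> F \<times> UNIV" using Cons.prems y by auto
  define g where "g x = of_bool (\<forall>(f, c)\<in>set B. f x > c) * (prod_list (map (\<lambda>f. f x) L))" for x
  have g_le: "\<bar>g x\<bar> \<le> 1" if "x \<in> space M" for x
  proof -
    have "\<bar>prod_list (map (\<lambda>f. f x) L)\<bar> \<le> 1"
      using Cons.prems(2) F_bounded[OF _ that]
      by (induction L) (auto simp: abs_mult intro: mult_le_one)
    then show ?thesis by (simp add: g_def abs_mult)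
  qed
  obtain p where p: "\<And>n. real_polynomial_function (p n)"
    "\<And>n t. \<bar>t\<bar> \<le> 1 \<Longrightarrow> \<bar>p n t\<bar> \<le> 2"
    "\<And>t. \<bar>t\<bar> \<le> 1 \<Longrightarrow> (\<lambda>n. p n t) \<longlonglongrightarrow> of_bool (t > c)"
    by (rule real_polynomials_to_step[of c]) blast
  have "(\<lambda>x. g x * p n (f x)) \<in> L2_closure M W" for n
  proof -
    obtain a m where pn: "p n = (\<lambda>x. \<Sum>i\<le>m. a i * x ^ i)"
      using p(1) unfolding real_polynomial_function_iff_sum by blast
    have mono: "(\<lambda>x. g x * f x ^ i) \<in> L2_closure M W" for i :: nat
    proof -
      have "set (replicate i f @ L) \<subseteq> F" using f Cons.prems(2) by auto
      from Cons.IH[OF B this] show ?thesis by (simp add: g_def mult_ac)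
    qed
    have "(\<lambda>x. \<Sum>i\<le>m. a i * (g x * f x ^ i)) \<in> L2_closure M W"
      by (intro closure_sum closure_scale mono)
    then show ?thesis by (simp add: pn sum_distrib_left mult_ac)
  qed
  then have "(\<lambda>x. g x * of_bool (f x > c)) \<in> L2_closure M W"
  proof (rule closure_dominated)
    show "(\<lambda>x. 2) \<in> L2 M M" by (rule L2_bounded[of _ 2]) auto
    fix x assume x: "x \<in> space M"
    show "(\<lambda>n. g x * p n (f x)) \<longlonglongrightarrow> g x * of_bool (f x > c)"
      by (intro tendsto_mult_left p(3) F_bounded[OF f x])
    show "\<bar>g x * p n (f x)\<bar> \<le> 2" for n
      using mult_mono[OF g_le[OF x] p(2)[OF F_bounded[OF f x], of n]] by (simp add: abs_mult)
  qed
  then show ?case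
    by (rule closure_cong) (auto simp: g_def y)
qed

lemma boxes_sets: "boxes M F \<subseteq> sets M"
proof
  fix A assume "A \<in> boxes M F"
  then obtain B where A: "A = {x \<in> space M. \<forall>(f, c)\<in>set B. f x > c}" "set B \<subseteq> F \<times> UNIV"
    unfolding boxes_def by blast
  have "{x \<in> space M. \<forall>(f, c)\<in>set B. f x > c} \<in> sets M"
    using A(2)
  proof (induction B)
    case (Cons y B)
    obtain f c where y: "y = (f, c)" by force
    have [measurable]: "f \<in> borel_measurable M" using Cons.prems y by (auto intro: F_measurable)
    have "{x \<in> space M. \<forall>(f, c)\<in>set (y # B). f x > c} =
        {x \<in> space M. f x > c} \<inter> {x \<in> space M. \<forall>(f, c)\<in>set B. f x > c}"
      by (auto simp: y)
    also have "\<dots> \<in> sets M" using Cons by (intro sets.Int) auto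
    finally show ?case .
  qed auto
  then show "A \<in> sets M" using A by simp
qed

lemma closure_indicator:
  assumes "A \<in> sigma_sets (space M) (boxes M F)"
  shows "indicat_real A \<in> L2_closure M W"
proof -
  have "Int_stable (boxes M F)"
  proof (rule Int_stableI)
    fix A B assume "A \<in> boxes M F" "B \<in> boxes M F"
    then obtain K L where *: "A = {x \<in> space M. \<forall>(f, c)\<in>set K. f x > c}" "set K \<subseteq> F \<times> UNIV"
      "B = {x \<in> space M. \<forall>(f, c)\<in>set L. f x > c}" "set L \<subseteq> F \<times> UNIV"
      unfolding boxes_def by blast
    then have "A \<inter> B = {x \<in> space M. \<forall>(f, c)\<in>set (K @ L). f x > c}" by auto
    moreover have "set (K @ L) \<subseteq> F \<times> UNIV" using * by auto
    ultimately show "A \<inter> B \<in> boxes M F" unfolding boxes_def by blast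
  qed
  moreover have "boxes M F \<subseteq> Pow (space M)" by (auto simp: boxes_def)
  ultimately show ?thesis using assms
  proof (induction rule: sigma_sets_induct_disjoint)
    case (basic A)
    then obtain B where A: "A = {x \<in> space M. \<forall>(f, c)\<in>set B. f x > c}" "set B \<subseteq> F \<times> UNIV"
      unfolding boxes_def by blast
    show ?case
      by (rule closure_cong[OF closure_box_times_monomial[OF A(2), of "[]"]])
         (auto simp: A(1) indicator_def)
  next
    case empty
    then show ?case using closure_incl subspace_zero by auto
  next
    case (compl A)
    have "(\<lambda>x. (prod_list (map (\<lambda>f. f x) [])) + (- 1) * indicat_real A x) \<in> L2_closure M W"
      by (intro closure_add closure_scale compl monomials) auto
    then show ?case by (rule closure_cong) (auto simp: indicator_def)
  next
    case (union A)
    have "(\<lambda>x. \<Sum>i<n. indicat_real (A i) x) \<in> L2_closure M W" for n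
      by (intro closure_sum union)
    then show ?case
    proof (rule closure_dominated)
      show "(\<lambda>x. 1) \<in> L2 M M" by (rule L2_bounded[of _ 1]) auto
      fix x
      have eq: "(\<Sum>i<n. indicat_real (A i) x) = indicator (\<Union>i<n. A i) x" for n
        using union(1) by (intro indicator_UN_disjoint[symmetric])
          (auto simp: disjoint_family_on_def)
      have "(\<lambda>n. indicat_real (\<Union>i<n. A i) x) \<longlonglongrightarrow> indicator (\<Union>i. A i) x"
        by (rule LIMSEQ_indicator_UN)
      then show "(\<lambda>n. \<Sum>i<n. indicat_real (A i) x) \<longlonglongrightarrow> indicator (\<Union>i. A i) x"
        by (simp add: eq)
      show "\<bar>\<Sum>i<n. indicat_real (A i) x\<bar> \<le> 1" for n
        by (simp add: eq)
    qed
  qed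
qed

lemma multiplicative_system_dense:
  assumes "sets N \<subseteq> sigma_sets (space M) (boxes M F)" "space N = space M" "Y \<in> L2 M N"
  shows "Y \<in> L2_closure M W"
proof -
  have Ym: "Y \<in> borel_measurable N" using assms(3) by (rule L2_measurable)
  have "sigma_sets (space M) (boxes M F) \<subseteq> sets M" using boxes_sets by (rule sets.sigma_sets_subset)
  then have sub: "sets N \<subseteq> sets M" using assms(1) by blast
  have "Y \<in> borel_measurable M"
    by (rule measurable_mono[THEN subsetD, OF _ _ _ _ Ym]) (use assms sub in auto)
  then have YL: "Y \<in> L2 M M" using assms(3) by (simp add: L2_def)
  obtain s where s: "\<And>i. simple_function N (s i)"
    "\<And>x. x \<in> space N \<Longrightarrow> (\<lambda>i. s i x) \<longlonglongrightarrow> Y x"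
    "\<And>i x. x \<in> space N \<Longrightarrow> dist (s i x) 0 \<le> 2 * dist (Y x) 0"
    using borel_measurable_implies_sequence_metric[OF Ym, of 0] by metis
  have "s i \<in> L2_closure M W" for i
  proof -
    have "(\<lambda>x. \<Sum>y\<in>s i ` space N. y * indicat_real (s i -` {y} \<inter> space N) x) \<in> L2_closure M W"
    proof (intro closure_sum closure_scale closure_indicator)
      fix y
      have "s i -` {y} \<inter> space N \<in> sets N" using s(1) by (auto simp: simple_functionD)
      then show "s i -` {y} \<inter> space N \<in> sigma_sets (space M) (boxes M F)" using assms(1) by blast
    qed
    then show ?thesis
    proof (rule closure_cong)
      fix x assume x: "x \<in> space M"
      have "(\<Sum>y\<in>s i ` space N. y * indicat_real (s i -` {y} \<inter> space N) x) =
          (\<Sum>y\<in>s i ` space N. if y = s i x then s i x else 0)"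
        using x assms(2) by (intro sum.cong) (auto simp: indicator_def)
      also have "\<dots> = s i x"
        using x assms(2) simple_functionD(1)[OF s(1)] by simp
      finally show "(\<Sum>y\<in>s i ` space N. y * indicat_real (s i -` {y} \<inter> space N) x) = s i x" .
    qed
  qed
  then show ?thesis
  proof (rule closure_dominated)
    show "(\<lambda>x. \<bar>2 * Y x\<bar>) \<in> L2 M M"
      using L2_scale[OF YL, of 2] by (auto simp: L2_def)
    fix x assume "x \<in> space M"
    then show "(\<lambda>n. s n x) \<longlonglongrightarrow> Y x" "\<bar>s n x\<bar> \<le> \<bar>2 * Y x\<bar>" for n
      using s(2,3)[of x] assms(2) by (auto simp: abs_mult)
  qed
qed

end

end

section \<open>The Borel sets of the group\<close>

lemma proj_norm_nonneg: "proj_norm k T \<ge> 0"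
  by (simp add: proj_norm_eq sum_nonneg)

lemma proj_norm_diff_le: "proj_norm k (\<lambda>w. T w - U w) \<le> proj_norm k T + proj_norm k U"
  unfolding proj_norm_eq by (simp flip: sum.distrib add: sum_mono abs_triangle_ineq4)

lemma proj_norm_triangle:
  "proj_norm k (\<lambda>w. T w - V w) \<le> proj_norm k (\<lambda>w. T w - U w) + proj_norm k (\<lambda>w. U w - V w)"
  unfolding proj_norm_eq by (simp flip: sum.distrib add: sum_mono)

lemma entire_diff:
  assumes "T \<in> entire_tseries" "U \<in> entire_tseries"
  shows "(\<lambda>w. T w - U w) \<in> entire_tseries"
  unfolding entire_tseries_def
proof (intro CollectI allI impI)
  fix l :: real assume l: "l > 0"
  have "summable (\<lambda>k. l ^ k * proj_norm k T + l ^ k * proj_norm k U)"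
    using assms l by (intro summable_add) (auto simp: entire_tseries_def)
  then show "summable (\<lambda>k. l ^ k * proj_norm k (\<lambda>w. T w - U w))"
    by (rule summable_comparison_test[rotated])
       (use l proj_norm_diff_le[of _ T U] in
         \<open>auto simp: proj_norm_nonneg simp flip: distrib_left intro!: exI mult_left_mono\<close>)
qed

lemma tseries_norm_mono:
  assumes "T \<in> entire_tseries" "0 < l" "l \<le> l'"
  shows "tseries_norm l T \<le> tseries_norm l' T"
  unfolding tseries_norm_def
  using assms by (intro suminf_le)
    (auto simp: entire_tseries_def proj_norm_nonneg intro!: mult_right_mono power_mono)

lemma tseries_norm_triangle:
  assumes "T \<in> entire_tseries" "U \<in> entire_tseries" "V \<in> entire_tseries" "l > 0"
  shows "tseries_norm l (\<lambda>w. T w - V w)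
    \<le> tseries_norm l (\<lambda>w. T w - U w) + tseries_norm l (\<lambda>w. U w - V w)"
proof -
  have s: "summable (\<lambda>k. l ^ k * proj_norm k (\<lambda>w. T w - V w))"
    "summable (\<lambda>k. l ^ k * proj_norm k (\<lambda>w. T w - U w))"
    "summable (\<lambda>k. l ^ k * proj_norm k (\<lambda>w. U w - V w))"
    using entire_diff[OF assms(1,3)] entire_diff[OF assms(1,2)] entire_diff[OF assms(2,3)] assms(4)
    by (auto simp: entire_tseries_def)
  have "tseries_norm l (\<lambda>w. T w - V w) \<le>
      suminf (\<lambda>k. l ^ k * proj_norm k (\<lambda>w. T w - U w) + l ^ k * proj_norm k (\<lambda>w. U w - V w))"
    unfolding tseries_norm_def
    using assms(4) proj_norm_triangle[of _ T V U]
    by (intro suminf_le s summable_add) (auto simp flip: distrib_left intro!: mult_left_mono)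
  also have "\<dots> = tseries_norm l (\<lambda>w. T w - U w) + tseries_norm l (\<lambda>w. U w - V w)"
    unfolding tseries_norm_def using s by (intro suminf_add[symmetric])
  finally show ?thesis .
qed

lemma tseries_norm_minus_commute:
  "tseries_norm l (\<lambda>w. T w - U w) = tseries_norm l (\<lambda>w. U w - T w)"
  by (simp add: tseries_norm_def proj_norm_eq abs_minus_commute)

lemma abs_coordinate_le:
  assumes "T \<in> entire_tseries"
  shows "\<bar>T w\<bar> \<le> tseries_norm 1 T"
proof -
  have s: "summable (\<lambda>k. 1 ^ k * proj_norm k T)"
    using assms zero_less_one unfolding entire_tseries_def by blast
  have "\<bar>T w\<bar> \<le> proj_norm (length w) T"
    unfolding proj_norm_eq
    using member_le_sum[of w "{v. length v = length w}" "\<lambda>v. \<bar>T v\<bar>"] by (simp add: finite_words)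
  also have "\<dots> \<le> tseries_norm 1 T"
    unfolding tseries_norm_def
    using sum_le_suminf[OF s, of "{length w}"] by (simp add: proj_norm_nonneg)
  finally show ?thesis .
qed

text \<open>
  The sets that generate \<open>entire_topology\<close>. The norms increase with \<open>l\<close>, so the balls around \<open>T\<close>
  form a neighbourhood base at \<open>T\<close>.
\<close>

abbreviation tseries_ball :: "'d::finite tseries \<Rightarrow> real \<Rightarrow> real \<Rightarrow> 'd tseries set" where
  "tseries_ball T l e \<equiv> {U \<in> entire_tseries. tseries_norm l (\<lambda>w. U w - T w) < e}"

lemma tseries_norm_self: "tseries_norm l (\<lambda>w. T w - T w) = 0"
  by (simp add: tseries_norm_def proj_norm_eq)

lemma openin_tseries_ball:
  "T \<in> entire_tseries \<Longrightarrow> l > 0 \<Longrightarrow> e > 0 \<Longrightarrow> openin entire_topology (tseries_ball T l e)"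
  unfolding entire_topology_def by (rule topology_generated_by_Basis) blast

lemma open_contains_ball:
  assumes "openin entire_topology V" "T \<in> V" "T \<in> entire_tseries"
  shows "\<exists>l>0. \<exists>e>0. tseries_ball T l e \<subseteq> V"
proof -
  have "generate_topology_on {tseries_ball T l e | T l e. T \<in> entire_tseries \<and> l > 0 \<and> e > 0} V"
    using assms(1) unfolding entire_topology_def openin_topology_generated_by_iff .
  then show ?thesis using assms(2)
  proof (induction rule: generate_topology_on.induct)
    case (Int A B)
    obtain l e where 1: "l > 0" "e > 0" "tseries_ball T l e \<subseteq> A" using Int by blast
    obtain l' e' where 2: "l' > 0" "e' > 0" "tseries_ball T l' e' \<subseteq> B" using Int by blast
    have "U \<in> A \<inter> B" if U: "U \<in> tseries_ball T (max l l') (min e e')" for U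
    proof -
      have "(\<lambda>w. U w - T w) \<in> entire_tseries" using U assms(3) by (auto intro: entire_diff)
      then have "tseries_norm l (\<lambda>w. U w - T w) \<le> tseries_norm (max l l') (\<lambda>w. U w - T w)"
        "tseries_norm l' (\<lambda>w. U w - T w) \<le> tseries_norm (max l l') (\<lambda>w. U w - T w)"
        using 1 2 by (auto intro: tseries_norm_mono)
      then have "U \<in> tseries_ball T l e" "U \<in> tseries_ball T l' e'" using U by auto
      then show ?thesis using 1(3) 2(3) by blast
    qed
    then show ?case using 1 2
      by (intro exI[of _ "max l l'"] exI[of _ "min e e'"] conjI subsetI) auto
  next
    case (UN K)
    then obtain A where "A \<in> K" "T \<in> A" by blast
    with UN.IH[OF this] show ?case by blast
  next
    case (Basis A)
    then obtain T0 l e where A: "A = tseries_ball T0 l e" "T0 \<in> entire_tseries" "l > 0" "e > 0"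
      by blast
    let ?r = "e - tseries_norm l (\<lambda>w. T w - T0 w)"
    have "U \<in> A" if U: "U \<in> tseries_ball T l ?r" for U
      using tseries_norm_triangle[of U T T0 l] U A assms(3) by auto
    moreover have "?r > 0" using Basis A by auto
    ultimately show ?case using A(3) by (intro exI[of _ l] exI[of _ ?r] conjI subsetI) auto
  qed auto
qed

lemma grouplike_entire: "T \<in> grouplike \<Longrightarrow> T \<in> entire_tseries"
  by (simp add: grouplike_def)

lemma space_borel_grouplike: "space borel_grouplike = grouplike"
proof -
  have "{U :: 'a tseries set. openin (subtopology entire_topology grouplike) U} \<subseteq> Pow grouplike"
    using openin_subset by fastforce
  then show ?thesis unfolding borel_grouplike_def by (rule space_measure_of)
qed

lemma sets_borel_grouplike:
  assumes "openin entire_topology V"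
  shows "grouplike \<inter> V \<in> sets borel_grouplike"
proof -
  have "{U. openin (subtopology entire_topology grouplike) U} \<subseteq> Pow grouplike"
    using openin_subset by fastforce
  moreover have "openin (subtopology entire_topology grouplike) (grouplike \<inter> V)"
    using assms by (rule openin_subtopology_Int2)
  ultimately show ?thesis unfolding borel_grouplike_def by (auto simp: sets_measure_of)
qed

lemma coordinate_measurable: "(\<lambda>T. T w) \<in> borel_measurable borel_grouplike"
  unfolding borel_measurable_iff_greater
proof (intro allI)
  fix c :: real
  define V where "V = \<Union>{tseries_ball T 1 (T w - c) | T. T \<in> entire_tseries \<and> T w > c}"
  have "openin entire_topology V"
    unfolding V_def by (intro openin_Union) (auto intro: openin_tseries_ball)
  then have "grouplike \<inter> V \<in> sets borel_grouplike" by (rule sets_borel_grouplike)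
  moreover have "grouplike \<inter> V = {T \<in> space borel_grouplike. c < T w}"
  proof (intro equalityI subsetI)
    fix U assume "U \<in> grouplike \<inter> V"
    then obtain T where T: "T \<in> entire_tseries" "U \<in> tseries_ball T 1 (T w - c)" "U \<in> grouplike"
      unfolding V_def by blast
    then have "\<bar>U w - T w\<bar> < T w - c"
      using abs_coordinate_le[OF entire_diff[of U T], of w] by auto
    then show "U \<in> {T \<in> space borel_grouplike. c < T w}"
      using T by (simp add: space_borel_grouplike)
  next
    fix U :: "'a tseries" assume "U \<in> {T \<in> space borel_grouplike. c < T w}"
    then have U: "U \<in> grouplike" "c < U w" by (auto simp: space_borel_grouplike)
    then have "U \<in> tseries_ball U 1 (U w - c)"
      using tseries_norm_self[of 1 U] grouplike_entire by auto
    then show "U \<in> grouplike \<inter> V" using U grouplike_entire unfolding V_def by blast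
  qed
  ultimately show "{T \<in> space borel_grouplike. c < T w} \<in> sets borel_grouplike" by simp
qed

text \<open>
  Finitely supported rational series, coded by association lists; they form a countable dense set.
\<close>

definition rat_series :: "('d list \<times> rat) list \<Rightarrow> 'd tseries" where
  "rat_series c w = (case map_of c w of None \<Rightarrow> 0 | Some q \<Rightarrow> of_rat q)"

lemma rat_series_entire: "rat_series c \<in> (entire_tseries :: 'd::finite tseries set)"
  unfolding entire_tseries_def
proof (intro CollectI allI impI)
  fix l :: real
  define N where "N = Suc (Max (length ` fst ` set c))"
  have "proj_norm k (rat_series c) = 0" if "k \<notin> {..<N}" for k
    unfolding proj_norm_eq
  proof (intro sum.neutral ballI)
    fix w :: "'d list" assume "w \<in> {w. length w = k}"
    then have k: "length w = k" by simp
    have "w \<notin> fst ` set c"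
    proof
      assume "w \<in> fst ` set c"
      then have "length w \<le> Max (length ` fst ` set c)" by (intro Max_ge) auto
      with k that show False by (simp add: N_def)
    qed
    then have "map_of c w = None" by (simp add: map_of_eq_None_iff)
    then show "\<bar>rat_series c w\<bar> = 0" by (simp add: rat_series_def)
  qed
  then show "summable (\<lambda>k. l ^ k * proj_norm k (rat_series c))"
    by (intro summable_finite[of "{..<N}"]) auto
qed

lemma rat_series_dense:
  fixes T :: "'d::finite tseries"
  assumes "T \<in> entire_tseries" "l > 0" "e > 0"
  shows "\<exists>c. tseries_norm l (\<lambda>w. T w - rat_series c w) < e"
proof -
  have sT: "summable (\<lambda>k. l ^ k * proj_norm k T)"
    using assms by (simp add: entire_tseries_def)
  obtain N where N: "norm (suminf (\<lambda>k. l ^ (k + N) * proj_norm (k + N) T)) < e / 2"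
    using suminf_exist_split[OF _ sT, of "e / 2"] assms(3) by auto
  define K where "K = (\<Sum>k<N. l ^ k * real (card {w :: 'd list. length w = k}))"
  have K: "K \<ge> 0" unfolding K_def using assms(2) by (intro sum_nonneg) auto
  define \<delta> where "\<delta> = e / 2 / (K + 1)"
  have \<delta>: "\<delta> > 0" using assms(3) K by (simp add: \<delta>_def)
  have "\<exists>q :: rat. \<bar>T w - of_rat q\<bar> \<le> \<delta>" for w
  proof -
    obtain q where "T w - \<delta> < of_rat q" "of_rat q < T w"
      using of_rat_dense[of "T w - \<delta>" "T w"] \<delta> by auto
    then show ?thesis by (intro exI[of _ q]) linarith
  qed
  then obtain q :: "'d list \<Rightarrow> rat" where q: "\<And>w. \<bar>T w - of_rat (q w)\<bar> \<le> \<delta>" by metis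
  have "finite {w :: 'd list. length w < N}"
    by (rule finite_subset[OF _ finite_lists_length_le[of "UNIV :: 'd set" N]]) auto
  then obtain ws where ws: "set ws = {w :: 'd list. length w < N}"
    using finite_list by blast
  define c where "c = map (\<lambda>w. (w, q w)) ws"
  have c: "rat_series c w = (if length w < N then of_rat (q w) else 0)" for w
    using ws by (simp add: rat_series_def c_def map_of_map_restrict restrict_map_def)
  define D where "D = (\<lambda>w. T w - rat_series c w)"
  have "D \<in> entire_tseries" unfolding D_def by (rule entire_diff[OF assms(1) rat_series_entire])
  then have sD: "summable (\<lambda>k. l ^ k * proj_norm k D)"
    using assms(2) by (simp add: entire_tseries_def)
  have low: "proj_norm k D \<le> real (card {w :: 'd list. length w = k}) * \<delta>" if "k < N" for k
    unfolding proj_norm_eq using q that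
    by (intro sum_bounded_above) (auto simp: D_def c)
  have high: "proj_norm (k + N) D = proj_norm (k + N) T" for k
    unfolding proj_norm_eq by (intro sum.cong) (auto simp: D_def c)
  have "tseries_norm l D =
      suminf (\<lambda>k. l ^ (k + N) * proj_norm (k + N) D) + (\<Sum>k<N. l ^ k * proj_norm k D)"
    unfolding tseries_norm_def by (rule suminf_split_initial_segment[OF sD])
  also have "suminf (\<lambda>k. l ^ (k + N) * proj_norm (k + N) D) < e / 2"
    using N by (simp add: high)
  also have "(\<Sum>k<N. l ^ k * proj_norm k D) \<le>
      (\<Sum>k<N. l ^ k * (real (card {w :: 'd list. length w = k}) * \<delta>))"
    using low assms(2) by (intro sum_mono mult_left_mono) auto
  also have "\<dots> = K * \<delta>" by (simp add: K_def sum_distrib_right mult.assoc)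
  also have "\<dots> \<le> e / 2"
  proof -
    have "K * \<delta> \<le> (K + 1) * \<delta>" using \<delta> by simp
    also have "\<dots> = e / 2"
      using iffD1[OF nonzero_eq_divide_eq \<delta>_def] K by (simp add: mult.commute)
    finally show ?thesis .
  qed
  finally show ?thesis unfolding D_def by auto
qed

text \<open>
  Balls around the coded series, with one integer parameter for both the norm and the radius,
  form a countable base.
\<close>

lemma open_contains_rat_ball:
  fixes T :: "'d::finite tseries"
  assumes "openin entire_topology V" "T \<in> V" "T \<in> entire_tseries"
  shows "\<exists>c n. T \<in> tseries_ball (rat_series c) (real (Suc n)) (1 / real (Suc n)) \<and>
    tseries_ball (rat_series c) (real (Suc n)) (1 / real (Suc n)) \<subseteq> V"
proof -
  obtain l e where le: "l > 0" "e > 0" "tseries_ball T l e \<subseteq> V"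
    using open_contains_ball[OF assms] by blast
  obtain n where n: "real n > max l (2 / e)" using reals_Archimedean2 by blast
  let ?n = "real (Suc n)"
  have n1: "l \<le> ?n" using n by simp
  have n2: "2 / ?n < e"
  proof -
    have "2 / e < ?n" using n by simp
    then show ?thesis using le(2) by (simp add: divide_simps mult.commute)
  qed
  obtain c where c: "tseries_norm ?n (\<lambda>w. T w - rat_series c w) < 1 / ?n"
    using rat_series_dense[OF assms(3), of ?n "1 / ?n"] by auto
  let ?R = "rat_series c"
  have R: "?R \<in> entire_tseries" by (rule rat_series_entire)
  have "U \<in> V" if U: "U \<in> tseries_ball ?R ?n (1 / ?n)" for U
  proof -
    have Ue: "U \<in> entire_tseries" using U by simp
    have "tseries_norm l (\<lambda>w. U w - T w) \<le> tseries_norm ?n (\<lambda>w. U w - T w)"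
      using n1 le(1) entire_diff[OF Ue assms(3)] by (intro tseries_norm_mono)
    also have "\<dots> \<le> tseries_norm ?n (\<lambda>w. U w - ?R w) + tseries_norm ?n (\<lambda>w. ?R w - T w)"
      using Ue R assms(3) by (intro tseries_norm_triangle) auto
    also have "\<dots> < 1 / ?n + 1 / ?n"
      using U c by (intro add_strict_mono) (auto simp: tseries_norm_minus_commute[of _ ?R T])
    also have "\<dots> < e" using n2 by simp
    finally show ?thesis using le(3) Ue by auto
  qed
  then show ?thesis using c assms(3) by (intro exI[of _ c] exI[of _ n]) auto
qed

text \<open>
  The coordinates generate the Borel sets of the group: an open set is a countable union of balls,
  and the norms are measurable functions of the coordinates.
\<close>

lemma measurable_borel_grouplike:
  fixes S :: "'a \<Rightarrow> 'd::finite tseries"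
  assumes "\<And>x. x \<in> space N \<Longrightarrow> S x \<in> grouplike"
    and "\<And>w. (\<lambda>x. S x w) \<in> borel_measurable N"
  shows "S \<in> N \<rightarrow>\<^sub>M borel_grouplike"
  unfolding borel_grouplike_def
proof (rule measurable_measure_of)
  show "{U :: 'd tseries set. openin (subtopology entire_topology grouplike) U} \<subseteq> Pow grouplike"
    using openin_subset by fastforce
  show "S \<in> space N \<rightarrow> grouplike" using assms(1) by blast
  fix U :: "'d tseries set"
  assume "U \<in> {U. openin (subtopology entire_topology grouplike) U}"
  then obtain V where V: "openin entire_topology V" "U = V \<inter> grouplike"
    by (auto simp: openin_subtopology)
  let ?B = "\<lambda>(c, n). tseries_ball (rat_series c) (real (Suc n)) (1 / real (Suc n)) :: 'd tseries set"
  define I where "I = {i. ?B i \<subseteq> V}"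
  have ball: "{x \<in> space N. S x \<in> ?B (c, n)} \<in> sets N" for c n
  proof -
    note assms(2)[measurable]
    have "{x \<in> space N. S x \<in> ?B (c, n)} =
        {x \<in> space N. tseries_norm (real (Suc n)) (\<lambda>w. S x w - rat_series c w) < 1 / real (Suc n)}"
      using assms(1) grouplike_entire by auto
    also have "\<dots> \<in> sets N"
      unfolding tseries_norm_def proj_norm_eq by measurable
    finally show ?thesis .
  qed
  have "S -` U \<inter> space N = (\<Union>i\<in>I. {x \<in> space N. S x \<in> ?B i})"
  proof (intro equalityI subsetI)
    fix x assume x: "x \<in> S -` U \<inter> space N"
    then have "S x \<in> V" "S x \<in> entire_tseries" using V(2) grouplike_entire by auto
    from open_contains_rat_ball[OF V(1) this] obtain i where "S x \<in> ?B i" "?B i \<subseteq> V" by force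
    then show "x \<in> (\<Union>i\<in>I. {x \<in> space N. S x \<in> ?B i})" using x unfolding I_def by blast
  next
    fix x assume "x \<in> (\<Union>i\<in>I. {x \<in> space N. S x \<in> ?B i})"
    then have "S x \<in> V" "x \<in> space N" unfolding I_def by blast+
    then show "x \<in> S -` U \<inter> space N" using V(2) assms(1) by auto
  qed
  also have "\<dots> \<in> sets N"
  proof (rule sets.countable_UN')
    show "countable I" by (rule countable_subset[OF subset_UNIV]) simp
    show "(\<lambda>i. {x \<in> space N. S x \<in> ?B i}) ` I \<subseteq> sets N"
    proof
      fix A assume "A \<in> (\<lambda>i. {x \<in> space N. S x \<in> ?B i}) ` I"
      then obtain i where "A = {x \<in> space N. S x \<in> ?B i}" by blast
      then show "A \<in> sets N" using ball[of "fst i" "snd i"] by (simp add: case_prod_unfold)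
    qed
  qed
  finally show "S -` U \<inter> space N \<in> sets N" .
qed

section \<open>Moments of the coordinates\<close>

lemma square_coordinate:
  fixes T :: "'d::finite tseries"
  assumes "T \<in> grouplike"
  defines "\<delta> \<equiv> \<lambda>w u. of_bool (u = w)"
  shows "(T w)\<^sup>2 = level_sum (deshuffle (\<delta> w) (\<delta> w)) T (2 * length w)"
proof -
  have "level_sum (deshuffle (\<delta> w) (\<delta> w)) T (2 * length w) =
      (\<Sum>(u, v)\<in>word_pairs (2 * length w). \<delta> w u * \<delta> w v * pairing (shuffle u v) T)"
    by (simp add: level_sum_def sum_pairing_shuffle)
  also have "\<dots> = (\<Sum>(u, v)\<in>{(w, w)}. pairing (shuffle u v) T)"
    by (rule sum.mono_neutral_cong_right) (auto simp: \<delta>_def finite_word_pairs)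
  also have "\<dots> = (T w)\<^sup>2"
    using assms(1) by (simp add: grouplike_def power2_eq_square)
  finally show ?thesis by simp
qed

text \<open>
  The square of the Hilbert--Schmidt norm of level \<open>k\<close>.
\<close>

definition sum_squares :: "'d::finite tseries \<Rightarrow> nat \<Rightarrow> real" where
  "sum_squares T k = (\<Sum>w | length w = k. (T w)\<^sup>2)"

lemma sum_squares_nonneg: "sum_squares T k \<ge> 0"
  by (simp add: sum_squares_def sum_nonneg)

lemma card_words: "card {w :: 'd::finite list. length w = k} = CARD('d) ^ k"
  using card_lists_length_eq[of "UNIV :: 'd set" k] by simp

lemma level_sum_square_le:
  fixes T :: "'d::finite tseries"
  assumes "\<And>w. \<bar>a w\<bar> \<le> C * r ^ length w"
  shows "(level_sum a T k)\<^sup>2 \<le> C\<^sup>2 * (r\<^sup>2 * real CARD('d)) ^ k * sum_squares T k"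
proof -
  have "(level_sum a T k)\<^sup>2 \<le> (\<Sum>w | length w = k. (a w)\<^sup>2) * sum_squares T k"
    unfolding level_sum_def sum_squares_def by (rule Cauchy_Schwarz_ineq_sum)
  also have "(\<Sum>w | length w = k. (a w)\<^sup>2) \<le> (\<Sum>w :: 'd list | length w = k. (C * r ^ k)\<^sup>2)"
  proof (rule sum_mono)
    fix w :: "'d list" assume "w \<in> {w. length w = k}"
    then show "(a w)\<^sup>2 \<le> (C * r ^ k)\<^sup>2"
      using power_mono[OF assms[of w], of 2] by simp
  qed
  also have "\<dots> = C\<^sup>2 * (r\<^sup>2 * real CARD('d)) ^ k"
    by (simp add: card_words power_mult_distrib mult_ac flip: power_mult)
  finally show ?thesis by (simp add: mult_right_mono sum_squares_nonneg)
qed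

lemma summable_sum_squares:
  assumes "T \<in> entire_tseries" "c > 0"
  shows "summable (\<lambda>k. c ^ k * sum_squares T k)"
proof -
  let ?g = "\<lambda>k. (c + 1) ^ k * proj_norm k T"
  have g: "summable ?g" using assms by (auto simp: entire_tseries_def)
  have "\<forall>\<^sub>F k in sequentially. ?g k < 1"
    using summable_LIMSEQ_zero[OF g] by (rule order_tendstoD) simp
  then have "\<forall>\<^sub>F k in sequentially. norm (c ^ k * sum_squares T k) \<le> ?g k"
  proof (eventually_elim)
    fix k assume 1: "?g k < 1"
    have "sum_squares T k \<le> (\<Sum>w | length w = k. \<bar>T w\<bar> * proj_norm k T)"
      unfolding sum_squares_def proj_norm_eq
    proof (rule sum_mono)
      fix w :: "'a list" assume "w \<in> {w. length w = k}"
      then have "\<bar>T w\<bar> \<le> (\<Sum>w | length w = k. \<bar>T w\<bar>)"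
        using member_le_sum[of w "{v. length v = k}" "\<lambda>v. \<bar>T v\<bar>"] by (simp add: finite_words)
      then have "\<bar>T w\<bar> * \<bar>T w\<bar> \<le> \<bar>T w\<bar> * (\<Sum>w | length w = k. \<bar>T w\<bar>)"
        by (rule mult_left_mono) simp
      then show "(T w)\<^sup>2 \<le> \<bar>T w\<bar> * (\<Sum>w | length w = k. \<bar>T w\<bar>)"
        by (simp add: power2_eq_square)
    qed
    also have "\<dots> = (proj_norm k T)\<^sup>2"
      by (simp add: proj_norm_eq power2_eq_square sum_distrib_right)
    finally have le: "sum_squares T k \<le> (proj_norm k T)\<^sup>2" .
    have "c ^ k * sum_squares T k \<le> ((c + 1) ^ k)\<^sup>2 * (proj_norm k T)\<^sup>2"
    proof (rule mult_mono)
      have "c ^ k * 1 \<le> (c + 1) ^ k * (c + 1) ^ k"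
        using assms(2) by (intro mult_mono power_mono one_le_power) auto
      then show "c ^ k \<le> ((c + 1) ^ k)\<^sup>2" by (simp add: power2_eq_square)
    qed (use le in \<open>auto simp: sum_squares_nonneg\<close>)
    also have "\<dots> = ?g k * ?g k" by (simp add: power2_eq_square mult_ac)
    also have "\<dots> \<le> ?g k * 1"
      using 1 assms(2) by (intro mult_left_mono) (auto simp: proj_norm_nonneg)
    finally show "norm (c ^ k * sum_squares T k) \<le> ?g k"
      using assms(2) by (simp add: sum_squares_nonneg)
  qed
  then show ?thesis using g by (rule summable_comparison_test_ev)
qed

text \<open>
  A random group-like series whose expectation is entire.
\<close>

locale random_grouplike = prob_space M for M :: "'a measure" +
  fixes S :: "'a \<Rightarrow> 'd::{finite, linorder} tseries"
  assumes S_measurable: "S \<in> M \<rightarrow>\<^sub>M borel_grouplike"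
    and S_integrable: "integrable M (\<lambda>x. S x w)"
    and expected_entire: "l > 0 \<Longrightarrow> summable (\<lambda>k. l ^ k * proj_norm k (\<lambda>w. \<integral>x. S x w \<partial>M))"
begin

lemma S_grouplike: "x \<in> space M \<Longrightarrow> S x \<in> grouplike"
  using measurable_space[OF S_measurable] by (simp add: space_borel_grouplike)

lemma S_entire: "x \<in> space M \<Longrightarrow> S x \<in> entire_tseries"
  using S_grouplike grouplike_entire by blast

lemma coordinate_borel [measurable]: "(\<lambda>x. S x w) \<in> borel_measurable M"
  using S_integrable by auto

lemma integral_level_sum:
  "integrable M (\<lambda>x. level_sum a (S x) k)"
  "(\<integral>x. level_sum a (S x) k \<partial>M) = level_sum a (\<lambda>w. \<integral>x. S x w \<partial>M) k"
  unfolding level_sum_def by (auto simp: S_integrable)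

text \<open>
  There are \<open>2 ^ (2 * length w)\<close> ways to split a word of length \<open>2 * length w\<close>, which bounds the
  coefficients of the shuffle of \<open>w\<close> with itself.
\<close>

lemma square_coordinate_moment:
  "integrable M (\<lambda>x. (S x w)\<^sup>2)"
  "(\<integral>x. (S x w)\<^sup>2 \<partial>M) \<le> 4 ^ length w * proj_norm (2 * length w) (\<lambda>w. \<integral>x. S x w \<partial>M)"
proof -
  define d where "d = deshuffle (\<lambda>u. of_bool (u = w)) (\<lambda>u. of_bool (u = w) :: real)"
  have eq: "(S x w)\<^sup>2 = level_sum d (S x) (2 * length w)" if "x \<in> space M" for x
    unfolding d_def by (rule square_coordinate[OF S_grouplike[OF that]])
  have d: "\<bar>d u\<bar> \<le> 1 * 2 ^ length u" for u
    using deshuffle_bound[of "\<lambda>u. of_bool (u = w)" 1 1 "\<lambda>u. of_bool (u = w)" 1 1 u]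
    by (simp add: d_def)
  show "integrable M (\<lambda>x. (S x w)\<^sup>2)"
    using integral_level_sum(1)[of d "2 * length w"]
    by (subst Bochner_Integration.integrable_cong[OF refl eq])
  have "(\<integral>x. (S x w)\<^sup>2 \<partial>M) = level_sum d (\<lambda>w. \<integral>x. S x w \<partial>M) (2 * length w)"
    unfolding integral_level_sum(2)[symmetric]
    by (intro Bochner_Integration.integral_cong refl eq)
  also have "\<dots> \<le> 1 * (2 ^ (2 * length w) * proj_norm (2 * length w) (\<lambda>w. \<integral>x. S x w \<partial>M))"
    using abs_level_sum_le[OF d, of "\<lambda>w. \<integral>x. S x w \<partial>M" "2 * length w"] by linarith
  finally show "(\<integral>x. (S x w)\<^sup>2 \<partial>M) \<le> 4 ^ length w * proj_norm (2 * length w) (\<lambda>w. \<integral>x. S x w \<partial>M)"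
    by (simp add: power_mult)
qed

lemma integrable_sum_squares: "integrable M (\<lambda>x. sum_squares (S x) k)"
  unfolding sum_squares_def using square_coordinate_moment(1) by simp

lemma integrable_weighted_squares:
  assumes "c > 0"
  shows "integrable M (\<lambda>x. suminf (\<lambda>k. c ^ k * sum_squares (S x) k))"
proof (rule integrable_suminf)
  show "integrable M (\<lambda>x. c ^ k * sum_squares (S x) k)" for k
    using integrable_sum_squares by simp
  show "AE x in M. summable (\<lambda>k. norm (c ^ k * sum_squares (S x) k))"
    using summable_sum_squares[OF S_entire assms] assms
    by (intro AE_I2) (simp add: sum_squares_nonneg)
  let ?E = "\<lambda>w. \<integral>x. S x w \<partial>M"
  let ?n = "real CARD('d)"
  \<comment> \<open>Level \<open>2 * k\<close> receives the weight \<open>(4 * ?n * c) ^ k\<close>, which is at most \<open>l ^ (2 * k)\<close> as \<open>l > 1\<close>.\<close>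
  define l where "l = 4 * ?n * c + 1"
  have l: "l > 1" "4 * ?n * c \<le> l" using assms by (auto simp: l_def)
  have "summable ((\<lambda>k. l ^ k * proj_norm k ?E) \<circ> (\<lambda>k. 2 * k))"
    using l by (intro summable_reindex expected_entire) (auto simp: inj_def proj_norm_nonneg)
  then have s: "summable (\<lambda>k. l ^ (2 * k) * proj_norm (2 * k) ?E)" by (simp add: comp_def)
  show "summable (\<lambda>k. \<integral>x. norm (c ^ k * sum_squares (S x) k) \<partial>M)"
  proof (rule summable_comparison_test[OF exI s], intro allI impI)
    fix k
    have "(\<integral>x. norm (c ^ k * sum_squares (S x) k) \<partial>M) = c ^ k * (\<integral>x. sum_squares (S x) k \<partial>M)"
      using assms by (simp add: sum_squares_nonneg abs_mult)
    also have "(\<integral>x. sum_squares (S x) k \<partial>M) = (\<Sum>w | length w = k. \<integral>x. (S x w)\<^sup>2 \<partial>M)"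
      unfolding sum_squares_def using square_coordinate_moment(1)
      by (intro Bochner_Integration.integral_sum)
    also have "\<dots> \<le> (\<Sum>w :: 'd list | length w = k. 4 ^ k * proj_norm (2 * k) ?E)"
      using square_coordinate_moment(2) by (intro sum_mono) auto
    also have "\<dots> = (4 * ?n) ^ k * proj_norm (2 * k) ?E"
      by (simp add: card_words power_mult_distrib mult_ac)
    finally have "(\<integral>x. norm (c ^ k * sum_squares (S x) k) \<partial>M) \<le>
        (4 * ?n * c) ^ k * proj_norm (2 * k) ?E"
      using assms by (simp add: power_mult_distrib mult_ac mult_left_mono)
    also have "\<dots> \<le> l ^ (2 * k) * proj_norm (2 * k) ?E"
    proof (rule mult_right_mono[OF _ proj_norm_nonneg])
      have "(4 * ?n * c) ^ k \<le> l ^ k" using l assms by (intro power_mono) auto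
      also have "\<dots> \<le> l ^ (2 * k)" using l by (intro power_increasing) auto
      finally show "(4 * ?n * c) ^ k \<le> l ^ (2 * k)" .
    qed
    finally show "norm (\<integral>x. norm (c ^ k * sum_squares (S x) k) \<partial>M) \<le> l ^ (2 * k) * proj_norm (2 * k) ?E"
      by (simp add: integral_nonneg_AE)
  qed
qed

section \<open>Density of the linear functionals\<close>

lemma S_measurable_sig: "S \<in> sig_algebra M S \<rightarrow>\<^sub>M borel_grouplike"
  unfolding sig_algebra_def
  using measurable_space[OF S_measurable] by (intro measurable_vimage_algebra1) auto

lemma sig_algebra_le:
  assumes "f \<in> borel_measurable (sig_algebra M S)"
  shows "f \<in> borel_measurable M"
proof -
  have "sets (sig_algebra M S) \<subseteq> sets M"
    unfolding sig_algebra_def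
    using S_measurable measurable_space[OF S_measurable]
    by (subst sets_vimage_algebra2) (auto intro: measurable_sets)
  then show ?thesis
    using assms by (intro measurable_mono[THEN subsetD, OF _ _ _ _ assms]) (auto simp: sig_algebra_def)
qed

lemma L2_sig: "f \<in> L2 M (sig_algebra M S) \<Longrightarrow> f \<in> L2 M M"
  using sig_algebra_le by (auto simp: L2_def)

lemma coordinate_L2: "(\<lambda>x. S x w) \<in> L2 M M"
  using square_coordinate_moment(1) by (simp add: L2_def)

lemma pairing_L2: "(\<lambda>x. pairing p (S x)) \<in> L2 M M"
  unfolding pairing_def by (intro L2_sum L2_scale coordinate_L2)

lemma pairing_L2_sig: "(\<lambda>x. pairing p (S x)) \<in> L2 M (sig_algebra M S)"
proof -
  have "(\<lambda>x. S x w) \<in> borel_measurable (sig_algebra M S)" for w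
    using measurable_compose[OF S_measurable_sig coordinate_measurable] .
  then have "(\<lambda>x. pairing p (S x)) \<in> borel_measurable (sig_algebra M S)"
    unfolding pairing_def by (intro borel_measurable_sum borel_measurable_times) auto
  then show ?thesis using pairing_L2[of p] by (simp add: L2_def)
qed

text \<open>
  The finite linear combinations of the coordinates of \<open>S\<close>.
\<close>

definition linear_span :: "('a \<Rightarrow> real) set" where
  "linear_span = {\<lambda>x. pairing p (S x) | p. True}"

sublocale L2_subspace M linear_span
proof
  show "linear_span \<subseteq> L2 M M" using pairing_L2 by (auto simp: linear_span_def)
  show "(\<lambda>x. 0) \<in> linear_span"
    unfolding linear_span_def by (intro CollectI exI[of _ 0]) simp
  fix f g assume "f \<in> linear_span" "g \<in> linear_span"
  then obtain p q where "f = (\<lambda>x. pairing p (S x))" "g = (\<lambda>x. pairing q (S x))"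
    unfolding linear_span_def by blast
  then show "(\<lambda>x. f x + g x) \<in> linear_span"
    unfolding linear_span_def by (intro CollectI exI[of _ "p + q"]) (simp add: pairing_add)
next
  fix f c assume "f \<in> linear_span"
  then obtain p where "f = (\<lambda>x. pairing p (S x))" unfolding linear_span_def by blast
  then show "(\<lambda>x. c * f x) \<in> linear_span"
    unfolding linear_span_def by (intro CollectI exI[of _ "scale c p"]) (simp add: pairing_scale)
qed

lemma coordinate_closure: "(\<lambda>x. S x w) \<in> L2_closure M linear_span"
proof -
  have "(\<lambda>x. S x w) \<in> linear_span"
    unfolding linear_span_def by (intro CollectI exI[of _ "word w"]) simp
  then show ?thesis using closure_incl by blast
qed

lemma functional_borel: "(\<lambda>x. functional a (S x)) \<in> borel_measurable M"
  unfolding functional_def level_sum_def by measurable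

text \<open>
  By Cauchy--Schwarz with weights \<open>2\<^sup>-\<^sup>k\<close> on the levels, the partial sums are dominated by the square
  root of a convergent weighted sum of squares of coordinates, which is integrable.
\<close>

lemma functional_closure:
  assumes "geom_bounded a"
  shows "(\<lambda>x. functional a (S x)) \<in> L2_closure M linear_span"
proof -
  obtain C r where C: "C > 0" "r > 0" "\<And>w. \<bar>a w\<bar> \<le> C * r ^ length w"
    using assms by (rule geom_boundedE) blast
  let ?n = "real CARD('d)"
  define c where "c = 4 * (r\<^sup>2 * ?n)"
  have c: "c > 0" using C by (simp add: c_def)
  define H where "H x = suminf (\<lambda>k. c ^ k * sum_squares (S x) k)" for x
  have H: "integrable M H" unfolding H_def by (rule integrable_weighted_squares[OF c])
  have H_nonneg: "H x \<ge> 0" if "x \<in> space M" for x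
    unfolding H_def using summable_sum_squares[OF S_entire[OF that] c] c
    by (intro suminf_nonneg) (auto simp: sum_squares_nonneg)
  have dom: "\<bar>\<Sum>k<m. level_sum a (S x) k\<bar> \<le> sqrt (2 * C\<^sup>2 * \<bar>H x\<bar>)" if x: "x \<in> space M" for m x
  proof (rule real_le_rsqrt)
    have "(\<Sum>k<m. level_sum a (S x) k)\<^sup>2 =
        (\<Sum>k<m. (1 / 2) ^ k * (2 ^ k * level_sum a (S x) k))\<^sup>2"
      by (simp add: power_one_over)
    also have "\<dots> \<le> (\<Sum>k<m. ((1 / 2) ^ k)\<^sup>2) * (\<Sum>k<m. (2 ^ k * level_sum a (S x) k)\<^sup>2)"
      by (rule Cauchy_Schwarz_ineq_sum)
    also have "\<dots> \<le> 2 * (C\<^sup>2 * H x)"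
    proof (rule mult_mono)
      have "(\<Sum>k<m. ((1 / 2) ^ k)\<^sup>2) = (\<Sum>k<m. (1 / 4 :: real) ^ k)"
        by (intro sum.cong) (auto simp: power2_eq_square simp flip: power_mult_distrib)
      also have "\<dots> \<le> suminf (\<lambda>k. (1 / 4 :: real) ^ k)"
        by (intro sum_le_suminf summable_geometric) auto
      also have "\<dots> \<le> 2" by (subst suminf_geometric) auto
      finally show "(\<Sum>k<m. ((1 / 2 :: real) ^ k)\<^sup>2) \<le> 2" .
      have "(\<Sum>k<m. (2 ^ k * level_sum a (S x) k)\<^sup>2) \<le>
          (\<Sum>k<m. C\<^sup>2 * (c ^ k * sum_squares (S x) k))"
      proof (rule sum_mono)
        fix k
        have "(2 ^ k * level_sum a (S x) k)\<^sup>2 = 4 ^ k * (level_sum a (S x) k)\<^sup>2"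
          by (simp add: power_mult_distrib power2_eq_square flip: power_mult_distrib)
        also have "\<dots> \<le> 4 ^ k * (C\<^sup>2 * (r\<^sup>2 * ?n) ^ k * sum_squares (S x) k)"
          by (intro mult_left_mono level_sum_square_le C) auto
        also have "\<dots> = C\<^sup>2 * (c ^ k * sum_squares (S x) k)"
          by (simp add: c_def power_mult_distrib mult_ac)
        finally show "(2 ^ k * level_sum a (S x) k)\<^sup>2 \<le> C\<^sup>2 * (c ^ k * sum_squares (S x) k)" .
      qed
      also have "\<dots> \<le> C\<^sup>2 * H x"
        unfolding H_def sum_distrib_left[symmetric] using c
        by (intro mult_left_mono sum_le_suminf summable_sum_squares[OF S_entire[OF x] c])
           (auto simp: sum_squares_nonneg)
      finally show "(\<Sum>k<m. (2 ^ k * level_sum a (S x) k)\<^sup>2) \<le> C\<^sup>2 * H x" .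
    qed (auto intro: sum_nonneg)
    finally show "\<bar>\<Sum>k<m. level_sum a (S x) k\<bar>\<^sup>2 \<le> 2 * C\<^sup>2 * \<bar>H x\<bar>"
      using H_nonneg[OF x] by (simp add: mult.assoc)
  qed
  have part: "(\<lambda>x. \<Sum>k<m. level_sum a (S x) k) \<in> L2_closure M linear_span" for m
    unfolding level_sum_def by (intro closure_sum closure_scale coordinate_closure)
  show ?thesis
  proof (rule closure_dominated[OF part])
    show "(\<lambda>x. sqrt (2 * C\<^sup>2 * \<bar>H x\<bar>)) \<in> L2 M M"
      unfolding L2_def using H by auto
    fix x assume x: "x \<in> space M"
    show "(\<lambda>m. \<Sum>k<m. level_sum a (S x) k) \<longlonglongrightarrow> functional a (S x)"
      unfolding functional_def
      using summable_level_sum(2)[OF S_entire[OF x] assms] by (rule summable_LIMSEQ)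
    show "\<bar>\<Sum>k<m. level_sum a (S x) k\<bar> \<le> sqrt (2 * C\<^sup>2 * \<bar>H x\<bar>)" for m
      by (rule dom[OF x])
  qed
qed

text \<open>
  The entries between the two ends of the path, for all words and all scalings of the matrices.
\<close>

definition matrix_coeffs :: "('a \<Rightarrow> real) set" where
  "matrix_coeffs = {\<lambda>x. functional (path_coeff w e 0) (S x) | w e. True}"

lemma matrix_coeffs_prod:
  assumes "set L \<subseteq> matrix_coeffs"
  shows "\<exists>a. geom_bounded a \<and> (\<forall>x\<in>space M. prod_list (map (\<lambda>f. f x) L) = functional a (S x))"
  using assms
proof (induction L)
  case Nil
  have "geom_bounded (\<lambda>v. of_bool (v = []))"
    unfolding geom_bounded_def by (rule exI[of _ 1], rule exI[of _ 1]) auto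
  moreover have "S x [] = 1" if "x \<in> space M" for x
    using S_grouplike[OF that] by (simp add: grouplike_def)
  ultimately show ?case by (intro exI[of _ "\<lambda>v. of_bool (v = [])"]) (simp add: functional_unit)
next
  case (Cons f L)
  then obtain w e where f: "f = (\<lambda>x. functional (path_coeff w e 0) (S x))"
    unfolding matrix_coeffs_def by auto
  from Cons obtain a where a: "geom_bounded a"
    "\<And>x. x \<in> space M \<Longrightarrow> prod_list (map (\<lambda>f. f x) L) = functional a (S x)" by auto
  show ?case
    using a functional_mult[OF S_grouplike geom_bounded_path_coeff a(1), of _ w e 0]
      geom_bounded_deshuffle[OF geom_bounded_path_coeff a(1)]
    by (intro exI[of _ "deshuffle (path_coeff w e 0) a"]) (auto simp: f)
qed

lemma sets_sig_algebra: "sets (sig_algebra M S) \<subseteq> sigma_sets (space M) (boxes M matrix_coeffs)"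
proof -
  define N where "N = sigma (space M) (boxes M matrix_coeffs)"
  have sub: "boxes M matrix_coeffs \<subseteq> Pow (space M)" by (auto simp: boxes_def)
  have N: "space N = space M" "sets N = sigma_sets (space M) (boxes M matrix_coeffs)"
    using sub by (simp_all add: N_def)
  have fm: "f \<in> borel_measurable N" if f: "f \<in> matrix_coeffs" for f
    unfolding borel_measurable_iff_greater
  proof
    fix c
    have "{x \<in> space M. c < f x} \<in> boxes M matrix_coeffs"
      unfolding boxes_def using f by (intro CollectI exI[of _ "[(f, c)]"]) auto
    then show "{x \<in> space N. c < f x} \<in> sets N" by (auto simp: N)
  qed
  have cm: "(\<lambda>x. S x w) \<in> borel_measurable N" for w
  proof (rule borel_measurable_LIMSEQ_real)
    let ?f = "\<lambda>n x. functional (path_coeff w (1 / real (Suc n)) 0) (S x)"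
    show "(\<lambda>n. real (Suc n) ^ length w * ?f n x) \<longlonglongrightarrow> S x w" if "x \<in> space N" for x
      using functional_path_coeff_tendsto[OF S_entire, of x w] that by (simp add: N)
    have "?f n \<in> borel_measurable N" for n
      by (rule fm) (auto simp: matrix_coeffs_def)
    then show "(\<lambda>x. real (Suc n) ^ length w * ?f n x) \<in> borel_measurable N" for n
      by (intro borel_measurable_times) auto
  qed
  have "S \<in> N \<rightarrow>\<^sub>M borel_grouplike"
    by (rule measurable_borel_grouplike) (auto simp: N S_grouplike cm)
  then have "{S -` A \<inter> space M | A. A \<in> sets borel_grouplike} \<subseteq> sets N"
    using measurable_sets[of S N borel_grouplike] by (auto simp: N(1))
  then show ?thesis
    unfolding sig_algebra_def N(2)[symmetric]
    using measurable_space[OF S_measurable] by (subst sets_vimage_algebra2) auto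
qed

theorem linear_functionals_dense:
  assumes "Y \<in> L2 M (sig_algebra M S)"
  shows "Y \<in> L2_closure M linear_span"
proof (rule multiplicative_system_dense[OF _ _ _ sets_sig_algebra _ assms])
  fix f x assume "f \<in> matrix_coeffs" "x \<in> space M"
  then show "\<bar>f x\<bar> \<le> 1"
    using functional_path_coeff_le_1[OF S_grouplike] by (auto simp: matrix_coeffs_def)
next
  fix f assume "f \<in> matrix_coeffs"
  then show "f \<in> borel_measurable M" by (auto simp: matrix_coeffs_def functional_borel)
next
  fix L assume "set L \<subseteq> matrix_coeffs"
  then obtain a where "geom_bounded a"
    "\<And>x. x \<in> space M \<Longrightarrow> prod_list (map (\<lambda>f. f x) L) = functional a (S x)"
    using matrix_coeffs_prod by blast
  then show "(\<lambda>x. prod_list (map (\<lambda>f. f x) L)) \<in> L2_closure M linear_span"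
    using functional_closure[of a] by (auto intro: closure_cong)
qed (simp add: sig_algebra_def)

end

section \<open>The order on words\<close>

lemma wf_word_less: "wf {(v :: 'd::{finite, linorder} list, w). v \<prec> w}"
proof -
  have "trans {(a :: 'd, b). a < b}" by (auto simp: trans_def)
  then have "wf {(a :: 'd, b). a < b}"
    by (intro finite_acyclic_wf) (auto simp: acyclic_def trancl_id)
  then have "wf (lenlex {(a :: 'd, b). a < b})" by (rule wf_lenlex)
  then show ?thesis by (simp add: word_less_def)
qed

lemma word_less_trans:
  fixes u v w :: "'d::linorder list"
  assumes "u \<prec> v" "v \<prec> w"
  shows "u \<prec> w"
proof -
  have "trans {(a :: 'd, b). a < b}" by (auto simp: trans_def)
  then show ?thesis using assms unfolding word_less_def by (meson lenlex_transI transD)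
qed

lemma word_less_linear: "v = w \<or> v \<prec> w \<or> w \<prec> (v :: 'd::linorder list)"
proof -
  have "total {(a :: 'd, b). a < b}" by (auto simp: total_on_def)
  from total_lenlex[OF this] show ?thesis by (auto simp: total_on_def word_less_def)
qed

lemma word_less_length: "v \<prec> w \<Longrightarrow> length v \<le> length w"
  unfolding word_less_def by (rule lenlex_length)

lemma finite_words_le: "finite {w :: 'd::finite list. length w \<le> n}"
  using finite_lists_length_le[of "UNIV :: 'd set" n] by simp

lemma finite_word_less: "finite {v :: 'd::{finite, linorder} list. v \<prec> w}"
  by (rule finite_subset[OF _ finite_words_le[of "length w"]]) (auto dest: word_less_length)

section \<open>Best approximation\<close>

text \<open>
  Pythagoras: \<open>Z\<close> is at least as close to \<open>Y\<close> as \<open>U\<close> when \<open>Y - Z\<close> is orthogonal to \<open>Z - U\<close>.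
\<close>

lemma integral_square_best:
  assumes "Y \<in> L2 M M" "Z \<in> L2 M M" "U \<in> L2 M M"
    and "L2_inner M (\<lambda>x. Y x - Z x) (\<lambda>x. Z x - U x) = 0"
  shows "(\<integral>x. (Y x - Z x)\<^sup>2 \<partial>M) \<le> (\<integral>x. (Y x - U x)\<^sup>2 \<partial>M)"
proof -
  let ?A = "\<lambda>x. Y x - Z x" and ?B = "\<lambda>x. Z x - U x"
  have L: "?A \<in> L2 M M" "?B \<in> L2 M M" using assms by (auto intro: L2_diff)
  note int = L2_integrable_square[OF L(1)] L2_integrable_square[OF L(2)] L2_integrable_mult[OF L]
  have "(\<integral>x. (Y x - U x)\<^sup>2 \<partial>M) = (\<integral>x. (?A x)\<^sup>2 + (?B x)\<^sup>2 + 2 * (?A x * ?B x) \<partial>M)"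
    by (intro Bochner_Integration.integral_cong refl) (simp add: power2_eq_square algebra_simps)
  also have "\<dots> = (\<integral>x. (?A x)\<^sup>2 \<partial>M) + (\<integral>x. (?B x)\<^sup>2 \<partial>M) + 2 * L2_inner M ?A ?B"
    unfolding L2_inner_def using int by simp
  finally show ?thesis using assms(4) by simp
qed

lemma L2_tendstoI:
  assumes "Y \<in> L2 M N" "\<forall>\<^sub>F i in net. Z i \<in> L2 M N"
    and "\<And>e. e > 0 \<Longrightarrow> \<forall>\<^sub>F i in net. (\<integral>x. (Y x - Z i x)\<^sup>2 \<partial>M) < e"
  shows "L2_tendsto M N Z Y net"
  unfolding L2_tendsto_def
proof (intro conjI assms(1,2))
  have "((\<lambda>i. \<integral>x. (Y x - Z i x)\<^sup>2 \<partial>M) \<longlongrightarrow> 0) net"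
  proof (rule order_tendstoI)
    fix a :: real assume "a < 0"
    moreover have "(\<integral>x. (Y x - Z i x)\<^sup>2 \<partial>M) \<ge> 0" for i by simp
    ultimately show "\<forall>\<^sub>F i in net. a < (\<integral>x. (Y x - Z i x)\<^sup>2 \<partial>M)"
      by (intro always_eventually allI) (rule less_le_trans)
  qed (rule assms(3))
  then have "((\<lambda>i. sqrt (\<integral>x. (Y x - Z i x)\<^sup>2 \<partial>M)) \<longlongrightarrow> sqrt 0) net"
    by (rule tendsto_real_sqrt)
  moreover have "L2_norm M (\<lambda>x. Z i x - Y x) = sqrt (\<integral>x. (Y x - Z i x)\<^sup>2 \<partial>M)" for i
    by (simp add: L2_norm_def L2_inner_def power2_commute flip: power2_eq_square)
  ultimately show "((\<lambda>i. L2_norm M (\<lambda>x. Z i x - Y x)) \<longlongrightarrow> 0) net" by simp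
qed

section \<open>Orthogonal polynomials\<close>

context random_grouplike begin

abbreviation "orth \<equiv> orth_poly M S"

text \<open>
  The words whose orthogonal polynomial is not almost surely zero; only these enter the recursion.
\<close>

definition positive :: "'d list set" where
  "positive = {v. form M S (orth v) (orth v) > 0}"

lemma form_integrable: "integrable M (\<lambda>x. pairing p (S x) * pairing q (S x))"
  by (intro L2_integrable_mult pairing_L2)

lemma form_commute: "form M S p q = form M S q p"
  by (simp add: form_def L2_inner_def mult.commute)

lemma form_diff_left: "form M S (p - q) r = form M S p r - form M S q r"
  unfolding form_def L2_inner_def using form_integrable
  by (simp add: pairing_diff left_diff_distrib)

lemma form_scale_left: "form M S (scale c p) r = c * form M S p r"
  unfolding form_def L2_inner_def by (simp add: pairing_scale mult.assoc)

lemma form_sum_left: "form M S (\<Sum>i\<in>I. p i) r = (\<Sum>i\<in>I. form M S (p i) r)"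
  unfolding form_def L2_inner_def using form_integrable
  by (simp add: pairing_sum sum_distrib_right)

lemma orth_poly_eq:
  "orth w = word w - (\<Sum>v\<in>{v \<in> positive. v \<prec> w}.
     scale (form M S (word w) (orth v) / form M S (orth v) (orth v)) (orth v))"
proof -
  have "{v. v \<prec> w \<and> form M S (orth v) (orth v) > 0} = {v \<in> positive. v \<prec> w}"
    by (auto simp: positive_def)
  then show ?thesis by (subst orth_poly.simps) simp
qed

lemma orth_poly_orthogonal_less:
  "u \<in> positive \<Longrightarrow> u \<prec> w \<Longrightarrow> form M S (orth w) (orth u) = 0"
proof (induction w arbitrary: u rule: wf_induct_rule[OF wf_word_less])
  case (1 w)
  let ?c = "\<lambda>v. form M S (word w) (orth v) / form M S (orth v) (orth v)"
  have zero: "form M S (orth v) (orth u) = 0" if v: "v \<in> positive" "v \<prec> w" "v \<noteq> u" for v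
  proof (cases "u \<prec> v")
    case True
    then show ?thesis using 1 v by simp
  next
    case False
    then have "v \<prec> u" using word_less_linear v by blast
    then have "form M S (orth u) (orth v) = 0" using 1 v by simp
    then show ?thesis by (simp add: form_commute)
  qed
  have "form M S (orth w) (orth u) = form M S (word w) (orth u) -
      (\<Sum>v\<in>{v \<in> positive. v \<prec> w}. ?c v * form M S (orth v) (orth u))"
    by (subst orth_poly_eq[of w]) (simp add: form_diff_left form_sum_left form_scale_left)
  also have "(\<Sum>v\<in>{v \<in> positive. v \<prec> w}. ?c v * form M S (orth v) (orth u)) =
      (\<Sum>v\<in>{v \<in> positive. v \<prec> w}. if v = u then form M S (word w) (orth u) else 0)"
    using zero by (intro sum.cong) (auto simp: positive_def)
  also have "\<dots> = form M S (word w) (orth u)"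
    using 1 finite_word_less[of w] by simp
  finally show ?case by simp
qed

lemma orth_poly_orthogonal:
  assumes "u \<in> positive" "v \<in> positive" "u \<noteq> v"
  shows "form M S (orth u) (orth v) = 0"
proof -
  have "u \<prec> v \<or> v \<prec> u" using word_less_linear assms by blast
  then show ?thesis
    using orth_poly_orthogonal_less assms form_commute by metis
qed

lemma keys_orth_poly: "Poly_Mapping.keys (orth w) \<subseteq> {u. u = w \<or> u \<prec> w}"
proof (induction w rule: wf_induct_rule[OF wf_word_less])
  case (1 w)
  show ?case
  proof
    fix u assume u: "u \<in> Poly_Mapping.keys (orth w)"
    let ?t = "\<lambda>v. scale (form M S (word w) (orth v) / form M S (orth v) (orth v)) (orth v)"
    have "Poly_Mapping.keys (orth w) \<subseteq> Poly_Mapping.keys (word w) \<union>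
        Poly_Mapping.keys (\<Sum>v\<in>{v \<in> positive. v \<prec> w}. ?t v)"
      by (subst orth_poly_eq) (rule keys_diff)
    moreover have "Poly_Mapping.keys (\<Sum>v\<in>{v \<in> positive. v \<prec> w}. ?t v) \<subseteq>
        (\<Union>v\<in>{v \<in> positive. v \<prec> w}. Poly_Mapping.keys (?t v))"
      by (rule Poly_Mapping.keys_sum)
    ultimately consider "u \<in> Poly_Mapping.keys (word w)"
      | v where "v \<prec> w" "u \<in> Poly_Mapping.keys (orth v)"
      using u keys_scale by fast
    then show "u \<in> {u. u = w \<or> u \<prec> w}"
    proof cases
      case (2 v)
      then have "u = v \<or> u \<prec> v" using 1 by blast
      then show ?thesis using 2 word_less_trans by blast
    qed (simp split: if_splits)
  qed
qed

lemma orth_poly_null: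
  assumes "w \<notin> positive"
  shows "AE x in M. pairing (orth w) (S x) = 0"
proof -
  have "form M S (orth w) (orth w) = (\<integral>x. (pairing (orth w) (S x))\<^sup>2 \<partial>M)"
    by (simp add: form_def L2_inner_def power2_eq_square)
  moreover have "(\<integral>x. (pairing (orth w) (S x))\<^sup>2 \<partial>M) \<ge> 0" by simp
  ultimately have "(\<integral>x. (pairing (orth w) (S x))\<^sup>2 \<partial>M) = 0"
    using assms unfolding positive_def mem_Collect_eq by linarith
  then have "AE x in M. (pairing (orth w) (S x))\<^sup>2 = 0"
    using pairing_L2[of "orth w"] by (subst (asm) integral_nonneg_eq_0_iff_AE) (auto simp: L2_def)
  then show ?thesis by simp
qed

text \<open>
  The recursion solved for \<open>w\<close>; the polynomial of \<open>w\<close> itself can be left out if it is a null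
  function.
\<close>

lemma coordinate_in_span:
  assumes "finite A" "{v \<in> positive. v = w \<or> v \<prec> w} \<subseteq> A"
  shows "\<exists>b. AE x in M. S x w = (\<Sum>v\<in>A. b v * pairing (orth v) (S x))"
proof -
  let ?c = "\<lambda>v. form M S (word w) (orth v) / form M S (orth v) (orth v)"
  let ?B = "{v \<in> positive. v \<prec> w}"
  define b where "b v = (if v \<in> ?B then ?c v else 0) + of_bool (v = w \<and> w \<in> positive)" for v
  have "S x w = pairing (orth w) (S x) + (\<Sum>v\<in>?B. ?c v * pairing (orth v) (S x))" for x
    by (subst orth_poly_eq[of w]) (simp add: pairing_diff pairing_sum pairing_scale)
  also have "(\<Sum>v\<in>?B. ?c v * pairing (orth v) (S x)) =
      (\<Sum>v\<in>A. (if v \<in> ?B then ?c v else 0) * pairing (orth v) (S x))" for x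
    using assms by (intro sum.mono_neutral_cong_left) auto
  finally have eq: "S x w = pairing (orth w) (S x) +
      (\<Sum>v\<in>A. (if v \<in> ?B then ?c v else 0) * pairing (orth v) (S x))" for x .
  have "AE x in M. pairing (orth w) (S x) =
      (\<Sum>v\<in>A. of_bool (v = w \<and> w \<in> positive) * pairing (orth v) (S x))"
  proof (cases "w \<in> positive")
    case True
    then have "w \<in> A" using assms(2) by blast
    have "(\<Sum>v\<in>A. of_bool (v = w \<and> w \<in> positive) * pairing (orth v) (S x)) =
        (\<Sum>v\<in>A. if v = w then pairing (orth w) (S x) else 0)" for x
      using True by (intro sum.cong) auto
    then show ?thesis using \<open>w \<in> A\<close> assms(1) by simp
  next
    case False
    then show ?thesis using orth_poly_null[OF False] by simp
  qed
  then have "AE x in M. S x w = (\<Sum>v\<in>A. b v * pairing (orth v) (S x))"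
    by eventually_elim (simp add: eq b_def distrib_right sum.distrib)
  then show ?thesis by blast
qed

lemma pairing_in_span:
  assumes "finite A"
    and "\<And>w. w \<in> Poly_Mapping.keys p \<Longrightarrow> {v \<in> positive. v = w \<or> v \<prec> w} \<subseteq> A"
  shows "\<exists>b. AE x in M. pairing p (S x) = (\<Sum>v\<in>A. b v * pairing (orth v) (S x))"
proof -
  have "\<forall>w\<in>Poly_Mapping.keys p. \<exists>b. AE x in M. S x w = (\<Sum>v\<in>A. b v * pairing (orth v) (S x))"
    using coordinate_in_span assms by blast
  from bchoice[OF this] obtain b where b: "\<forall>w\<in>Poly_Mapping.keys p.
      AE x in M. S x w = (\<Sum>v\<in>A. b w v * pairing (orth v) (S x))" ..
  let ?b = "\<lambda>v. \<Sum>w\<in>Poly_Mapping.keys p. Poly_Mapping.lookup p w * b w v"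
  have "AE x in M. \<forall>w\<in>Poly_Mapping.keys p. S x w = (\<Sum>v\<in>A. b w v * pairing (orth v) (S x))"
    using b by (intro AE_finite_allI) auto
  then have "AE x in M. pairing p (S x) = (\<Sum>v\<in>A. ?b v * pairing (orth v) (S x))"
  proof eventually_elim
    case (elim x)
    have "pairing p (S x) = (\<Sum>w\<in>Poly_Mapping.keys p. \<Sum>v\<in>A.
        Poly_Mapping.lookup p w * b w v * pairing (orth v) (S x))"
      unfolding pairing_def[of p] using elim
      by (intro sum.cong refl) (simp add: sum_distrib_left mult.assoc)
    also have "\<dots> = (\<Sum>v\<in>A. ?b v * pairing (orth v) (S x))"
      by (subst sum.swap) (simp add: sum_distrib_right)
    finally show ?case .
  qed
  then show ?thesis by (rule exI[of _ ?b])
qed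

section \<open>The chaos expansion\<close>

context
  fixes Y :: "'a \<Rightarrow> real"
  assumes Y_L2: "Y \<in> L2 M M"
begin

text \<open>
  The part of the expansion in orthogonal polynomials that belongs to the words in \<open>A\<close>. For
  finite \<open>A \<subseteq> positive\<close> it is the orthogonal projection of \<open>Y\<close> onto the span of the orthogonal polynomials of \<open>A\<close>.
\<close>

definition chaos_sum :: "'d list set \<Rightarrow> 'a \<Rightarrow> real" where
  "chaos_sum A x = (\<Sum>v\<in>A. pairing (chaos_coeff M S Y v) (S x))"

lemma chaos_sum_L2: "chaos_sum A \<in> L2 M M"
  unfolding chaos_sum_def by (intro L2_sum pairing_L2)

lemma chaos_sum_orthogonal:
  assumes "finite A" "A \<subseteq> positive" "v \<in> A"
  shows "L2_inner M (\<lambda>x. Y x - chaos_sum A x) (\<lambda>x. pairing (orth v) (S x)) = 0"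
proof -
  let ?c = "\<lambda>u. L2_inner M Y (\<lambda>x. pairing (orth u) (S x)) / form M S (orth u) (orth u)"
  have "L2_inner M (\<lambda>x. Y x - chaos_sum A x) (\<lambda>x. pairing (orth v) (S x)) =
      (\<integral>x. Y x * pairing (orth v) (S x) -
        (\<Sum>u\<in>A. ?c u * (pairing (orth u) (S x) * pairing (orth v) (S x))) \<partial>M)"
    unfolding L2_inner_def chaos_sum_def chaos_coeff_def
    by (simp add: pairing_scale left_diff_distrib sum_distrib_right mult.assoc)
  also have "\<dots> = L2_inner M Y (\<lambda>x. pairing (orth v) (S x)) -
      (\<Sum>u\<in>A. ?c u * form M S (orth u) (orth v))"
    using form_integrable L2_integrable_mult[OF Y_L2 pairing_L2]
    by (simp add: L2_inner_def form_def)
  also have "(\<Sum>u\<in>A. ?c u * form M S (orth u) (orth v)) =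
      (\<Sum>u\<in>A. if u = v then L2_inner M Y (\<lambda>x. pairing (orth v) (S x)) else 0)"
  proof (rule sum.cong)
    fix u assume "u \<in> A"
    then have "u \<in> positive" "v \<in> positive" using assms by auto
    then show "?c u * form M S (orth u) (orth v) =
        (if u = v then L2_inner M Y (\<lambda>x. pairing (orth v) (S x)) else 0)"
      using orth_poly_orthogonal[of u v] by (cases "u = v") (simp_all add: positive_def)
  qed simp
  finally show ?thesis using assms(1,3) by simp
qed

lemma chaos_sum_orthogonal_span:
  assumes "finite A" "A \<subseteq> positive" and "U \<in> L2 M M"
    and "AE x in M. U x = (\<Sum>v\<in>A. b v * pairing (orth v) (S x))"
  shows "L2_inner M (\<lambda>x. Y x - chaos_sum A x) U = 0"
proof -
  let ?D = "\<lambda>x. Y x - chaos_sum A x"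
  have D: "?D \<in> L2 M M" using L2_diff[OF Y_L2 chaos_sum_L2] .
  have "L2_inner M ?D U = (\<integral>x. ?D x * (\<Sum>v\<in>A. b v * pairing (orth v) (S x)) \<partial>M)"
    unfolding L2_inner_def
  proof (rule integral_cong_AE)
    show "(\<lambda>x. ?D x * U x) \<in> borel_measurable M"
      using L2_integrable_mult[OF D assms(3)] by auto
    show "(\<lambda>x. ?D x * (\<Sum>v\<in>A. b v * pairing (orth v) (S x))) \<in> borel_measurable M"
      using L2_integrable_mult[OF D L2_sum[OF L2_scale[OF pairing_L2]]] by auto
  qed (use assms(4) in auto)
  also have "\<dots> = (\<integral>x. (\<Sum>v\<in>A. b v * (?D x * pairing (orth v) (S x))) \<partial>M)"
    by (simp add: sum_distrib_left mult.left_commute)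
  also have "\<dots> = (\<Sum>v\<in>A. b v * L2_inner M ?D (\<lambda>x. pairing (orth v) (S x)))"
    unfolding L2_inner_def using L2_integrable_mult[OF D pairing_L2] by simp
  also have "\<dots> = 0"
    using chaos_sum_orthogonal[OF assms(1,2)] by (intro sum.neutral) auto
  finally show ?thesis .
qed

lemma chaos_sum_best:
  assumes "finite A" "A \<subseteq> positive"
    and "\<And>w. w \<in> Poly_Mapping.keys p \<Longrightarrow> {v \<in> positive. v = w \<or> v \<prec> w} \<subseteq> A"
  shows "(\<integral>x. (Y x - chaos_sum A x)\<^sup>2 \<partial>M) \<le> (\<integral>x. (Y x - pairing p (S x))\<^sup>2 \<partial>M)"
proof (rule integral_square_best[OF Y_L2 chaos_sum_L2 pairing_L2])
  from pairing_in_span[OF assms(1,3)]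
  obtain b where b: "AE x in M. pairing p (S x) = (\<Sum>v\<in>A. b v * pairing (orth v) (S x))" ..
  let ?c = "\<lambda>u. L2_inner M Y (\<lambda>x. pairing (orth u) (S x)) / form M S (orth u) (orth u)"
  have "AE x in M. chaos_sum A x - pairing p (S x) =
      (\<Sum>v\<in>A. (?c v - b v) * pairing (orth v) (S x))"
    using b
    by eventually_elim
      (simp add: chaos_sum_def chaos_coeff_def pairing_scale left_diff_distrib sum_subtractf)
  then show "L2_inner M (\<lambda>x. Y x - chaos_sum A x) (\<lambda>x. chaos_sum A x - pairing p (S x)) = 0"
    by (intro chaos_sum_orthogonal_span[OF assms(1,2)] L2_diff chaos_sum_L2 pairing_L2)
qed

lemma finite_positive_le: "finite {v \<in> positive. length v \<le> n}"
  by (rule finite_subset[OF _ finite_words_le[of n]]) auto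

lemma keys_chaos_coeff: "Poly_Mapping.keys (chaos_coeff M S Y v) \<subseteq> {w. length w \<le> length v}"
proof -
  have "Poly_Mapping.keys (chaos_coeff M S Y v) \<subseteq> Poly_Mapping.keys (orth v)"
    unfolding chaos_coeff_def by (rule keys_scale)
  also have "\<dots> \<subseteq> {w. w = v \<or> w \<prec> v}" by (rule keys_orth_poly)
  also have "\<dots> \<subseteq> {w. length w \<le> length v}" using word_less_length by blast
  finally show ?thesis .
qed

text \<open>
  Projections onto the levels up to \<open>N\<close> exist, as the expansion over the words of length at most
  \<open>N\<close> is one. Hence the chosen representative has the defining property, too, and no more than that
  is used of it.
\<close>

lemma proj_upto_spec:
  "\<exists>q. proj_upto M S N Y = (\<lambda>x. pairing q (S x)) \<and>
    Poly_Mapping.keys q \<subseteq> {w. length w \<le> N} \<and>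
    (\<forall>p. Poly_Mapping.keys p \<subseteq> {w. length w \<le> N} \<longrightarrow>
      L2_inner M (\<lambda>x. Y x - pairing q (S x)) (\<lambda>x. pairing p (S x)) = 0)"
proof -
  define V where "V = {\<lambda>x. pairing p (S x) | p. Poly_Mapping.keys p \<subseteq> {w. length w \<le> N}}"
  let ?P = "\<lambda>Z. Z \<in> V \<and> (\<forall>U\<in>V. L2_inner M (\<lambda>x. Y x - Z x) U = 0)"
  let ?A = "{v \<in> positive. length v \<le> N}"
  have "?P (chaos_sum ?A)"
  proof (intro conjI ballI)
    have "Poly_Mapping.keys (\<Sum>v\<in>?A. chaos_coeff M S Y v) \<subseteq>
        (\<Union>v\<in>?A. Poly_Mapping.keys (chaos_coeff M S Y v))" by (rule Poly_Mapping.keys_sum)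
    also have "\<dots> \<subseteq> {w. length w \<le> N}"
    proof (rule UN_least)
      fix v assume "v \<in> ?A"
      then show "Poly_Mapping.keys (chaos_coeff M S Y v) \<subseteq> {w. length w \<le> N}"
        using keys_chaos_coeff[of v] by auto
    qed
    finally show "chaos_sum ?A \<in> V"
      unfolding V_def chaos_sum_def
      by (intro CollectI exI[of _ "\<Sum>v\<in>?A. chaos_coeff M S Y v"]) (simp add: pairing_sum)
    fix U assume "U \<in> V"
    then obtain p where p: "U = (\<lambda>x. pairing p (S x))" "Poly_Mapping.keys p \<subseteq> {w. length w \<le> N}"
      unfolding V_def by blast
    have "{v \<in> positive. v = w \<or> v \<prec> w} \<subseteq> ?A" if "w \<in> Poly_Mapping.keys p" for w
      using p(2) that word_less_length[of _ w] by force
    from pairing_in_span[OF finite_positive_le this]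
    obtain b where "AE x in M. pairing p (S x) = (\<Sum>v\<in>?A. b v * pairing (orth v) (S x))" ..
    then show "L2_inner M (\<lambda>x. Y x - chaos_sum ?A x) U = 0"
      unfolding p(1) by (intro chaos_sum_orthogonal_span[OF finite_positive_le _ pairing_L2]) auto
  qed
  then have "?P (SOME Z. ?P Z)" by (rule someI[of ?P])
  then have *: "?P (proj_upto M S N Y)"
    unfolding proj_upto_def orth_proj_def V_def .
  then obtain q where q: "proj_upto M S N Y = (\<lambda>x. pairing q (S x))"
    "Poly_Mapping.keys q \<subseteq> {w. length w \<le> N}" unfolding V_def by blast
  have "L2_inner M (\<lambda>x. Y x - pairing q (S x)) (\<lambda>x. pairing p (S x)) = 0"
    if "Poly_Mapping.keys p \<subseteq> {w. length w \<le> N}" for p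
  proof -
    have "(\<lambda>x. pairing p (S x)) \<in> V" using that unfolding V_def by blast
    with * show ?thesis unfolding q(1) by simp
  qed
  with q show ?thesis by blast
qed

lemma proj_upto_best:
  assumes "Poly_Mapping.keys p \<subseteq> {w. length w \<le> N}"
  shows "(\<integral>x. (Y x - proj_upto M S N Y x)\<^sup>2 \<partial>M) \<le> (\<integral>x. (Y x - pairing p (S x))\<^sup>2 \<partial>M)"
proof -
  from proj_upto_spec[of N] obtain q where q: "proj_upto M S N Y = (\<lambda>x. pairing q (S x))"
    "Poly_Mapping.keys q \<subseteq> {w. length w \<le> N}"
    "\<forall>p. Poly_Mapping.keys p \<subseteq> {w. length w \<le> N} \<longrightarrow>
      L2_inner M (\<lambda>x. Y x - pairing q (S x)) (\<lambda>x. pairing p (S x)) = 0"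
    by (elim exE conjE) rule
  have "Poly_Mapping.keys (q - p) \<subseteq> {w. length w \<le> N}"
    using keys_diff[of q p] q(2) assms by blast
  with q(3) have "L2_inner M (\<lambda>x. Y x - pairing q (S x)) (\<lambda>x. pairing (q - p) (S x)) = 0"
    by simp
  then show ?thesis
    unfolding q(1) by (intro integral_square_best Y_L2 pairing_L2) (simp add: pairing_diff)
qed

lemma sum_proj_level:
  "(\<Sum>n<N. proj_level M S n Y x) = (if N = 0 then 0 else proj_upto M S (N - 1) Y x)"
proof (induction N)
  case (Suc N)
  then show ?case by (cases N) (simp_all add: proj_level_def)
qed simp

end

text \<open>
  Both partial sums are best approximations from subspaces that eventually contain any given
  combination of words, and some such combination is close to \<open>Y\<close> by density.
\<close>

theorem chaos_expansion:
  assumes Y: "Y \<in> L2 M (sig_algebra M S)"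
  shows "L2_tendsto M (sig_algebra M S) (\<lambda>N x. \<Sum>n<N. proj_level M S n Y x) Y sequentially"
    and "L2_tendsto M (sig_algebra M S) (\<lambda>A x. \<Sum>v\<in>A. pairing (chaos_coeff M S Y v) (S x)) Y
      (finite_subsets_at_top positive)"
proof -
  have YL: "Y \<in> L2 M M" using Y by (rule L2_sig)
  have approx: "\<exists>p. (\<integral>x. (Y x - pairing p (S x))\<^sup>2 \<partial>M) < e" if "e > 0" for e
  proof -
    have "\<exists>u\<in>linear_span. (\<integral>x. (Y x - u x)\<^sup>2 \<partial>M) < e"
      using linear_functionals_dense[OF Y] that by (simp add: L2_closure_def)
    then show ?thesis unfolding linear_span_def by auto
  qed
  show "L2_tendsto M (sig_algebra M S) (\<lambda>N x. \<Sum>n<N. proj_level M S n Y x) Y sequentially"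
  proof (rule L2_tendstoI[OF Y])
    have "(\<lambda>x. \<Sum>n<N. proj_level M S n Y x) \<in> L2 M (sig_algebra M S)" if "N > 0" for N
    proof -
      obtain q where "proj_upto M S (N - 1) Y = (\<lambda>x. pairing q (S x))"
        using proj_upto_spec[OF YL, of "N - 1"] by blast
      then show ?thesis using that pairing_L2_sig by (simp add: sum_proj_level[OF YL])
    qed
    then show "\<forall>\<^sub>F N in sequentially.
        (\<lambda>x. \<Sum>n<N. proj_level M S n Y x) \<in> L2 M (sig_algebra M S)"
      using eventually_gt_at_top[of 0] by (rule eventually_mono[rotated])
    fix e :: real assume "e > 0"
    from approx[OF this] obtain p where p: "(\<integral>x. (Y x - pairing p (S x))\<^sup>2 \<partial>M) < e" ..
    obtain m where m: "Poly_Mapping.keys p \<subseteq> {w. length w \<le> m}"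
      using finite_nat_set_iff_bounded_le[of "length ` Poly_Mapping.keys p"] by auto
    have "(\<integral>x. (Y x - (\<Sum>n<N. proj_level M S n Y x))\<^sup>2 \<partial>M) < e" if "N > m" for N
    proof -
      have "Poly_Mapping.keys p \<subseteq> {w. length w \<le> N - 1}" using m that by fastforce
      from proj_upto_best[OF YL this] p that show ?thesis by (simp add: sum_proj_level[OF YL])
    qed
    then show "\<forall>\<^sub>F N in sequentially. (\<integral>x. (Y x - (\<Sum>n<N. proj_level M S n Y x))\<^sup>2 \<partial>M) < e"
      using eventually_gt_at_top[of m] by (rule eventually_mono[rotated])
  qed
  show "L2_tendsto M (sig_algebra M S) (\<lambda>A x. \<Sum>v\<in>A. pairing (chaos_coeff M S Y v) (S x)) Y
      (finite_subsets_at_top positive)"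
  proof (rule L2_tendstoI[OF Y])
    have "(\<lambda>x. \<Sum>v\<in>A. pairing (chaos_coeff M S Y v) (S x)) \<in> L2 M (sig_algebra M S)" for A
      using pairing_L2_sig by (simp flip: pairing_sum)
    then show "\<forall>\<^sub>F A in finite_subsets_at_top positive.
        (\<lambda>x. \<Sum>v\<in>A. pairing (chaos_coeff M S Y v) (S x)) \<in> L2 M (sig_algebra M S)" by simp
    fix e :: real assume "e > 0"
    from approx[OF this] obtain p where p: "(\<integral>x. (Y x - pairing p (S x))\<^sup>2 \<partial>M) < e" ..
    let ?B = "\<Union>w\<in>Poly_Mapping.keys p. {v \<in> positive. v = w \<or> v \<prec> w}"
    have "finite {v \<in> positive. v = w \<or> v \<prec> w}" for w
      by (rule finite_subset[of _ "insert w {v. v \<prec> w}"]) (auto simp: finite_word_less)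
    then have B: "finite ?B" "?B \<subseteq> positive" by auto
    show "\<forall>\<^sub>F A in finite_subsets_at_top positive.
        (\<integral>x. (Y x - (\<Sum>v\<in>A. pairing (chaos_coeff M S Y v) (S x)))\<^sup>2 \<partial>M) < e"
      unfolding eventually_finite_subsets_at_top
    proof (intro exI[of _ ?B] conjI B allI impI)
      fix A assume "finite A \<and> ?B \<subseteq> A \<and> A \<subseteq> positive"
      then have "(\<integral>x. (Y x - chaos_sum Y A x)\<^sup>2 \<partial>M) \<le> (\<integral>x. (Y x - pairing p (S x))\<^sup>2 \<partial>M)"
        by (intro chaos_sum_best[OF YL]) auto
      then show "(\<integral>x. (Y x - (\<Sum>v\<in>A. pairing (chaos_coeff M S Y v) (S x)))\<^sup>2 \<partial>M) < e"
        using p by (simp add: chaos_sum_def[OF YL])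
    qed
  qed
qed

end

theorem corollary2p3:
  fixes M :: "'a measure" and S :: "'a \<Rightarrow> 'd::{finite, linorder} tseries"
    and Y :: "'a \<Rightarrow> real"
  assumes "prob_space M"
    and "S \<in> M \<rightarrow>\<^sub>M borel_grouplike"
    and "\<And>w. integrable M (\<lambda>x. S x w)"
    and "\<And>l. l > 0 \<Longrightarrow> summable (\<lambda>k. l ^ k * proj_norm k (\<lambda>w. \<integral>x. S x w \<partial>M))"
    and "Y \<in> L2 M (sig_algebra M S)"
  shows "L2_tendsto M (sig_algebra M S)
           (\<lambda>N x. \<Sum>n<N. proj_level M S n Y x) Y sequentially \<and>
         L2_tendsto M (sig_algebra M S)
           (\<lambda>A x. \<Sum>v\<in>A. pairing (chaos_coeff M S Y v) (S x)) Y
           (finite_subsets_at_top {v. form M S (orth_poly M S v) (orth_poly M S v) > 0})"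
proof -
  have R: "random_grouplike M S"
    by (intro random_grouplike.intro random_grouplike_axioms.intro assms)
  show ?thesis
    using random_grouplike.chaos_expansion[OF R assms(5)]
    unfolding random_grouplike.positive_def[OF R] by (rule conjI)
qed

end
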